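(* Let $f\colon I\to I$ be a tent map of slope $\lambda\in(\sqrt2,2)$ on its dynamical interval $I=[a,b]$, with turning point $c$. Suppose that $f$ is either of irrational type, or of rational endpoint type. Write $\kappa=\kappa(f)$ for the kneading sequence of $f$. Let $S\in\{0,1\}^{\mathbb Z}$. Then $S\in J_f$ (i.e. $S$ is an itinerary of some point of the inverse limit $\widehat I$) if and only if the following three conditions hold: (a) $\overleftarrow{\sigma^r(S)}\preceq\kappa$ for all $r\in\mathbb Z$; (b) $S$ does not end $0^\infty$; and (c) if $f$ is of rational left hand endpoint type and $\overrightarrow{\sigma^r(S)}=\kappa$ for some $r\in\mathbb Z$, then $S_{r-1}=1$.
   Context: **Tent maps.** $I=[a,b]$ is a compact interval and $f\colon I\to I$ is a (continuous) tent map of slope $\lambda\in(\sqrt2,2)$: there is $c\in(a,b)$ such that $f$ has constant slope $\lambda$ on $[a,c]$ and constant slope $-\lambda$ on $[c,b]$. $I$ is the dynamical interval (core) of $f$: $f(c)=b$ and $f(b)=a$. **Sequences.** $\mathbb N=\{0,1,2,\dots\}$. $\sigma$ denotes the shift map on $\{0,1\}^{\mathbb N}$ and on $\{0,1\}^{\mathbb Z}$: $\sigma(s)_i=s_{i+1}$. For $S\in\{0,1\}^{\mathbb Z}$, define $\overrightarrow S,\overleftarrow S\in\{0,1\}^{\mathbb N}$ by $\overrightarrow S_r=S_r$ and $\overleftarrow S_r=S_{-1-r}$ for $r\ge0$; so $\overrightarrow{\sigma^r(S)}=S_rS_{r+1}\ldots$ and $\overleftarrow{\sigma^r(S)}=S_{r-1}S_{r-2}\ldots$.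 $S$ *does not end $0^\infty$* if infinitely many entries of $\overrightarrow S$ are $1$. A word is even (odd) if it contains an even (odd) number of $1$s. $W^\infty$ denotes infinite repetition of the word $W$. **Unimodal order.** For distinct $s,t\in\{0,1\}^{\mathbb N}$, $s\prec t$ iff the word $s_0\ldots s_r$ is even, where $r\ge0$ is least with $s_r\ne t_r$. $\preceq$ is the corresponding non-strict order. **Itineraries and kneading sequence.** If $c$ is periodic of period $n$, let $\varepsilon(f)=0$ (resp. $1$) if an even (resp. odd) number of the points $f^r(c)$, $1\le r<n$, lie in $(c,b]$; the itinerary $j(x)\in\{0,1\}^{\mathbb N}$ of $x\in I$ has $j(x)_r=0$, $1$, or $\varepsilon(f)$ according as $f^r(x)\in[a,c)$, $f^r(x)\in(c,b]$, or $f^r(x)=c$; and $\kappa(f)=j(b)$. If $c$ is not periodic, $s\in\{0,1\}^{\mathbb N}$ is an itinerary of $x\in I$ if $f^r(x)\in[a,c]$ whenever $s_r=0$ and $f^r(x)\in[c,b]$ whenever $s_r=1$; and $\kappa(f)$ is the (unique) itinerary of $b$. **Inverse limit.** $\widehat I=\{\mathbf x\in I^{\mathbb Z}: f(x_r)=x_{r+1}\text{ for all }r\in\mathbb Z\}$. If $c$ is periodic, the unique itinerary $J(\mathbf x)\in\{0,1\}^{\mathbb Z}$ of $\mathbf x\in\widehat I$ has $J(\mathbf x)_r=0$, $1$, or $\varepsilon(f)$ according as $x_r\in[a,c)$, $x_r\in(c,b]$, or $x_r=c$. If $c$ is not periodic, $S\in\{0,1\}^{\mathbb Z}$ is an itinerary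 of $\mathbf x$ if $x_r\in[a,c]$ whenever $S_r=0$ and $x_r\in[c,b]$ whenever $S_r=1$. $J_f\subset\{0,1\}^{\mathbb Z}$ is the set of all itineraries of points of $\widehat I$. **Height.** All rationals $m/n$ are in lowest terms. For $q\in(0,1/2]$ and $i\ge1$, let $k_i(q)$ be two less than the number of vertical lines $x=\text{integer}$ in $\mathbb R^2$ which the line $y=qx$ intersects for $y\in[i-1,i]$. If $q=m/n$ is rational, let $c_q=10^{k_1(q)}110^{k_2(q)}11\ldots110^{k_m(q)}1\in\{0,1\}^{n+1}$. The height of $s\in\{0,1\}^{\mathbb N}$ is $q(s)=\inf\left(\{q\in(0,1/2]\cap\mathbb Q:(c_q0)^\infty\prec s\}\cup\{1/2\}\right)\in[0,1/2]$. The condition $\lambda\in(\sqrt2,2)$ is equivalent to $q(\kappa(f))\in(0,1/2)$. For rational $q=m/n\in(0,1/2)$, let $w_q\in\{0,1\}^{n-1}$ consist of the first $n-1$ symbols of $c_q$ (so $c_q=w_q01$), let $\widehat w_q$ be the reverse of $w_q$, and set $\operatorname{lhe}(q)=(w_q1)^\infty$, $\operatorname{rhe}(q)=c_q(1\widehat w_q)^\infty$. **Types.** $f$ is of *irrational type* if $q(\kappa(f))$ is irrational; of *rational left hand (resp. right hand) endpoint type* if $\kappa(f)=\operatorname{lhe}(q)$ (resp. $\operatorname{rhe}(q)$) for some rational $q\in(0,1/2)$; *rational endpoint type* means either of these. *)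

theory Defs
  imports Complex_Main "HOL-Library.Omega_Words_Fun" "HOL-Library.Z2"
begin

section \<open>Symbol sequences\<close>

text \<open>Finite words are of type \<^typ>\<open>bit list\<close>, one-sided sequences of type \<^typ>\<open>bit word\<close>
  (that is, \<^typ>\<open>nat \<Rightarrow> bit\<close>), two-sided sequences of type \<^typ>\<open>int \<Rightarrow> bit\<close>.\<close>

text \<open>The \<open>r\<close>-th power, for \<open>r\<close> an arbitrary integer, of the shift on two-sided sequences.\<close>

definition shift_pow :: "int \<Rightarrow> (int \<Rightarrow> bit) \<Rightarrow> (int \<Rightarrow> bit)" where
  "shift_pow r S = (\<lambda>i. S (i + r))"

definition forward :: "(int \<Rightarrow> bit) \<Rightarrow> bit word" where
  "forward S = (\<lambda>r. S (int r))"

definition backward :: "(int \<Rightarrow> bit) \<Rightarrow> bit word" where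
  "backward S = (\<lambda>r. S (- 1 - int r))"

definition ends_in_zeros :: "(int \<Rightarrow> bit) \<Rightarrow> bool" where
  "ends_in_zeros S \<longleftrightarrow> finite {r. forward S r = 1}"

definition even_word :: "bit list \<Rightarrow> bool" where
  "even_word w \<longleftrightarrow> even (count_list w 1)"

definition unimodal_less :: "bit word \<Rightarrow> bit word \<Rightarrow> bool" (infix \<open>\<prec>\<close> 50) where
  "s \<prec> t \<longleftrightarrow> s \<noteq> t \<and> even_word (prefix (Suc (LEAST r. s r \<noteq> t r)) s)"

definition unimodal_le :: "bit word \<Rightarrow> bit word \<Rightarrow> bool" (infix \<open>\<preceq>\<close> 50) where
  "s \<preceq> t \<longleftrightarrow> s = t \<or> s \<prec> t"


section \<open>Tent maps, itineraries and the inverse limit\<close>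

text \<open>Only the values of \<open>f\<close> on \<open>{a..b}\<close> matter.\<close>

definition tent_map :: "(real \<Rightarrow> real) \<Rightarrow> real \<Rightarrow> real \<Rightarrow> real \<Rightarrow> real \<Rightarrow> bool" where
  "tent_map f a b c slope \<longleftrightarrow>
     a < c \<and> c < b \<and>
     f ` {a..b} \<subseteq> {a..b} \<and> continuous_on {a..b} f \<and>
     (\<forall>x\<in>{a..c}. \<forall>y\<in>{a..c}. f y - f x = slope * (y - x)) \<and>
     (\<forall>x\<in>{c..b}. \<forall>y\<in>{c..b}. f y - f x = - slope * (y - x)) \<and>
     f c = b \<and> f b = a"

definition periodic_pt :: "(real \<Rightarrow> real) \<Rightarrow> real \<Rightarrow> bool" where
  "periodic_pt f x \<longleftrightarrow> (\<exists>n\<ge>1. (f ^^ n) x = x)"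

definition period :: "(real \<Rightarrow> real) \<Rightarrow> real \<Rightarrow> nat" where
  "period f x = (LEAST n. n \<ge> 1 \<and> (f ^^ n) x = x)"

definition turning_symbol :: "(real \<Rightarrow> real) \<Rightarrow> real \<Rightarrow> real \<Rightarrow> bit" where
  "turning_symbol f b c =
     (if even (card {r. 1 \<le> r \<and> r < period f c \<and> (f ^^ r) c \<in> {c<..b}}) then 0 else 1)"

text \<open>\<open>codes f a b c y s\<close>: the symbol \<open>s\<close> is admissible for the point \<open>y\<close> of \<open>{a..b}\<close>. If \<open>c\<close> is
  periodic there is exactly one such \<open>s\<close>; otherwise both symbols are admissible for \<open>y = c\<close>.\<close>

definition codes :: "(real \<Rightarrow> real) \<Rightarrow> real \<Rightarrow> real \<Rightarrow> real \<Rightarrow> real \<Rightarrow> bit \<Rightarrow> bool" where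
  "codes f a b c y s \<longleftrightarrow>
     (if periodic_pt f c
      then s = (if y \<in> {a..<c} then 0 else if y \<in> {c<..b} then 1 else turning_symbol f b c)
      else (s = 0 \<longrightarrow> y \<in> {a..c}) \<and> (s = 1 \<longrightarrow> y \<in> {c..b}))"

definition is_itinerary ::
  "(real \<Rightarrow> real) \<Rightarrow> real \<Rightarrow> real \<Rightarrow> real \<Rightarrow> real \<Rightarrow> bit word \<Rightarrow> bool" where
  "is_itinerary f a b c x s \<longleftrightarrow> (\<forall>r. codes f a b c ((f ^^ r) x) (s r))"

definition kneading_seq :: "(real \<Rightarrow> real) \<Rightarrow> real \<Rightarrow> real \<Rightarrow> real \<Rightarrow> bit word" where
  "kneading_seq f a b c = (THE s. is_itinerary f a b c b s)"

definition inverse_limit :: "(real \<Rightarrow> real) \<Rightarrow> real \<Rightarrow> real \<Rightarrow> (int \<Rightarrow> real) set" where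
  "inverse_limit f a b = {x. \<forall>r. x r \<in> {a..b} \<and> f (x r) = x (r + 1)}"

definition is_inverse_limit_itinerary ::
  "(real \<Rightarrow> real) \<Rightarrow> real \<Rightarrow> real \<Rightarrow> real \<Rightarrow> (int \<Rightarrow> real) \<Rightarrow> (int \<Rightarrow> bit) \<Rightarrow> bool" where
  "is_inverse_limit_itinerary f a b c x S \<longleftrightarrow> (\<forall>r. codes f a b c (x r) (S r))"

definition inverse_limit_itineraries ::
  "(real \<Rightarrow> real) \<Rightarrow> real \<Rightarrow> real \<Rightarrow> real \<Rightarrow> (int \<Rightarrow> bit) set" where
  "inverse_limit_itineraries f a b c =
     {S. \<exists>x\<in>inverse_limit f a b. is_inverse_limit_itinerary f a b c x S}"


section \<open>Height\<close>

text \<open>The line \<open>y = q x\<close> meets the vertical line \<open>x = v\<close> at height \<open>q v\<close>. For \<open>0 < q \<le> 1/2\<close> the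
  cardinality is at least 2, so the subtraction does not truncate.\<close>

definition height_k :: "nat \<Rightarrow> real \<Rightarrow> nat" where
  "height_k i q = card {v::int. q * of_int v \<in> {real i - 1..real i}} - 2"

text \<open>Numerator and denominator in lowest terms (for positive \<open>q\<close>).\<close>

definition numer :: "rat \<Rightarrow> nat" where
  "numer q = nat (fst (quotient_of q))"

definition denom :: "rat \<Rightarrow> nat" where
  "denom q = nat (snd (quotient_of q))"

text \<open>\<open>1 0^{k_1} 11 0^{k_2} 11 \<dots> 11 0^{k_m} 1\<close> where \<open>m\<close> is the numerator of \<open>q\<close>.\<close>

definition c_word :: "rat \<Rightarrow> bit list" where
  "c_word q =
     [1] @ replicate (height_k 1 (of_rat q)) 0 @
     concat (map (\<lambda>i. [1, 1] @ replicate (height_k i (of_rat q)) 0) [2..<Suc (numer q)]) @ [1]"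

definition w_word :: "rat \<Rightarrow> bit list" where
  "w_word q = take (denom q - 1) (c_word q)"

definition height :: "bit word \<Rightarrow> real" where
  "height s =
     Inf ({of_rat q | q. 0 < q \<and> q \<le> 1 / 2 \<and> (c_word q @ [0])\<^sup>\<omega> \<prec> s} \<union> {1 / 2})"

definition lhe :: "rat \<Rightarrow> bit word" where
  "lhe q = (w_word q @ [1])\<^sup>\<omega>"

definition rhe :: "rat \<Rightarrow> bit word" where
  "rhe q = c_word q \<frown> ([1] @ rev (w_word q))\<^sup>\<omega>"


section \<open>Types of tent maps\<close>

definition irrational_type :: "(real \<Rightarrow> real) \<Rightarrow> real \<Rightarrow> real \<Rightarrow> real \<Rightarrow> bool" where
  "irrational_type f a b c \<longleftrightarrow> height (kneading_seq f a b c) \<notin> \<rat>"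

definition rational_left_endpoint_type :: "(real \<Rightarrow> real) \<Rightarrow> real \<Rightarrow> real \<Rightarrow> real \<Rightarrow> bool" where
  "rational_left_endpoint_type f a b c \<longleftrightarrow>
     (\<exists>q. 0 < q \<and> q < 1 / 2 \<and> kneading_seq f a b c = lhe q)"

definition rational_right_endpoint_type :: "(real \<Rightarrow> real) \<Rightarrow> real \<Rightarrow> real \<Rightarrow> real \<Rightarrow> bool" where
  "rational_right_endpoint_type f a b c \<longleftrightarrow>
     (\<exists>q. 0 < q \<and> q < 1 / 2 \<and> kneading_seq f a b c = rhe q)"

definition rational_endpoint_type :: "(real \<Rightarrow> real) \<Rightarrow> real \<Rightarrow> real \<Rightarrow> real \<Rightarrow> bool" where
  "rational_endpoint_type f a b c \<longleftrightarrow>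
     rational_left_endpoint_type f a b c \<or> rational_right_endpoint_type f a b c"

end

theory Submission
  imports Defs
begin

text \<open>
  The classical description of the itineraries of the inverse limit is in terms of forward
  sequences: \<open>S\<close> is an itinerary iff no forward sequence \<open>forward (shift_pow r S)\<close> exceeds the
  kneading sequence \<open>\<kappa>\<close>, ones occur arbitrarily far to the left and to the right, and, when \<open>c\<close>
  is periodic, each \<open>\<kappa>\<close> is preceded by the turning symbol
  (\<open>itinerary_iff_forward_nonperiodic\<close>, \<open>itinerary_iff_forward_periodic\<close>). The theorem holds
  because, for the kneading sequences in question, the bound on forward sequences is invariant
  under reversal of \<open>S\<close>.

  In all three cases \<open>\<kappa>\<close> has the form \<open>1 0\<dots>0 11 0\<dots>0 11 0\<dots>\<close>, where the \<open>i\<close>-th pair \<open>11\<close> starts in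
  a position \<open>p i\<close>. With \<open>\<theta>\<close> the reciprocal of the height, or of the rational \<open>q\<close> in \<open>lhe q\<close> and
  \<open>rhe q\<close>, \<open>p i = \<lfloor>i \<theta>\<rfloor>\<close> for irrational type and for
  right hand endpoints, and \<open>p i = \<lceil>i \<theta>\<rceil> - 1\<close> for left hand endpoints. Both functions are
  superadditive, and this is all that the symmetry needs.

  Since the even prefixes of \<open>\<kappa>\<close> are those ending with the first one of some pair, a
  sequence exceeds \<open>\<kappa>\<close> iff it follows \<open>\<kappa>\<close> up to position \<open>p i\<close> and has a zero there. Deleting the
  leading one leaves a word of length \<open>p i\<close> composed of blocks \<open>0\<close> and \<open>i - 1\<close> blocks \<open>11\<close>.
  Conversely, take any factor of \<open>S\<close> of length at least \<open>p (n + 1)\<close> composed of zeros and \<open>n\<close> blocks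
  \<open>11\<close>, with \<open>n\<close> minimal and, after prolonging it to the left, preceded by a one. By minimality the
  part before the \<open>j\<close>-th pair is shorter than \<open>p j\<close> and the part after it is shorter than
  \<open>p (n + 1 - j)\<close>; superadditivity then leaves only position \<open>p j\<close> for that pair, so \<open>S\<close> follows
  \<open>\<kappa>\<close> up to \<open>p (n + 1)\<close> and exceeds it there (\<open>minimal_chain_agrees\<close>). The existence of such an
  overlong factor is visibly symmetric under reversal.

  What remains is to identify the three kneading sequences (\<open>lhe_eq\<close>, \<open>rhe_eq\<close>,
  \<open>irrational_height_seq\<close>) and to see that \<open>c\<close> is periodic exactly in the left hand case: the
  sequence \<open>\<lceil>i \<theta>\<rceil> - 1\<close> with rational \<open>\<theta>\<close> gives a periodic word, while \<open>\<lfloor>i \<theta>\<rfloor>\<close> never does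
  (\<open>floor_seq_not_periodic\<close>).
\<close>

section \<open>Signs and the unimodal order\<close>

definition symbol_sign :: "bit \<Rightarrow> real" where
  "symbol_sign e = (if e = 1 then -1 else 1)"

text \<open>The sign with which the iterate of a tent map along the branches coded by the first \<open>n\<close>
  symbols reacts to a change of the starting point; it is \<open>1\<close> exactly for even prefixes.\<close>

definition word_sign :: "bit word \<Rightarrow> nat \<Rightarrow> real" where
  "word_sign s n = (\<Prod>i<n. symbol_sign (s i))"

lemma symbol_sign_simps [simp]: "symbol_sign 0 = 1" "symbol_sign 1 = -1"
  by (auto simp: symbol_sign_def)

lemma symbol_sign_cases: "symbol_sign e = 1 \<or> symbol_sign e = -1"
  by (simp add: symbol_sign_def)

lemma symbol_sign_square [simp]: "symbol_sign e * symbol_sign e = 1"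
  by (simp add: symbol_sign_def)

lemma symbol_sign_neq: "e \<noteq> e' \<Longrightarrow> symbol_sign e' = - symbol_sign e"
  by (cases e; cases e') (auto simp: symbol_sign_def)

lemma word_sign_0 [simp]: "word_sign s 0 = 1"
  by (simp add: word_sign_def)

lemma word_sign_Suc [simp]: "word_sign s (Suc n) = word_sign s n * symbol_sign (s n)"
  by (simp add: word_sign_def)

lemma word_sign_cases: "word_sign s n = 1 \<or> word_sign s n = -1"
proof (induction n)
  case (Suc n)
  then show ?case using symbol_sign_cases[of "s n"] by auto
qed simp

lemma abs_word_sign [simp]: "\<bar>word_sign s n\<bar> = 1"
  using word_sign_cases[of s n] by auto

lemma word_sign_cong: "(\<And>i. i < n \<Longrightarrow> s i = t i) \<Longrightarrow> word_sign s n = word_sign t n"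
  by (simp add: word_sign_def)

lemma word_sign_prefix: "word_sign s n = (if even_word (prefix n s) then 1 else -1)"
proof (induction n)
  case 0
  then show ?case by (simp add: even_word_def)
next
  case (Suc n)
  then show ?case by (cases "s n") (auto simp: even_word_def split: if_splits)
qed

lemma unimodal_less_iff:
  "s \<prec> t \<longleftrightarrow> (\<exists>r. (\<forall>i<r. s i = t i) \<and> s r \<noteq> t r \<and> word_sign s (Suc r) = 1)"
proof
  assume st: "s \<prec> t"
  define r where "r = (LEAST r. s r \<noteq> t r)"
  from st have "\<exists>r. s r \<noteq> t r" by (auto simp: unimodal_less_def)
  then have "s r \<noteq> t r" unfolding r_def by (rule LeastI_ex)
  moreover have "\<forall>i<r. s i = t i" unfolding r_def using not_less_Least by blast
  moreover have "word_sign s (Suc r) = 1"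
    using st unfolding unimodal_less_def word_sign_prefix r_def by simp
  ultimately show "\<exists>r. (\<forall>i<r. s i = t i) \<and> s r \<noteq> t r \<and> word_sign s (Suc r) = 1" by blast
next
  assume "\<exists>r. (\<forall>i<r. s i = t i) \<and> s r \<noteq> t r \<and> word_sign s (Suc r) = 1"
  then obtain r where r: "\<forall>i<r. s i = t i" "s r \<noteq> t r" "word_sign s (Suc r) = 1" by blast
  have "(LEAST r. s r \<noteq> t r) = r"
    using r by (intro Least_equality) (auto simp flip: not_less)
  then show "s \<prec> t"
    using r by (auto simp: unimodal_less_def word_sign_prefix split: if_splits)
qed

lemma first_difference:
  assumes "s \<noteq> (t :: 'a word)"
  obtains r where "\<forall>i<r. s i = t i" "s r \<noteq> t r"
proof -
  define r where "r = (LEAST r. s r \<noteq> t r)"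
  have "\<exists>r. s r \<noteq> t r" using assms by auto
  then have "s r \<noteq> t r" unfolding r_def by (rule LeastI_ex)
  moreover have "\<forall>i<r. s i = t i" unfolding r_def using not_less_Least by blast
  ultimately show ?thesis using that by blast
qed

lemma unimodal_less_at:
  assumes "\<forall>i<r. s i = t i" "s r \<noteq> t r"
  shows "s \<prec> t \<longleftrightarrow> word_sign s (Suc r) = 1"
proof
  assume "s \<prec> t"
  then obtain q where q: "\<forall>i<q. s i = t i" "s q \<noteq> t q" "word_sign s (Suc q) = 1"
    by (auto simp: unimodal_less_iff)
  have "q = r" using q assms by (meson linorder_neqE_nat)
  then show "word_sign s (Suc r) = 1" using q by simp
qed (use assms unimodal_less_iff in blast)

text \<open>Totality of the order: the two prefixes that end at the first difference have opposite parity.\<close>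

lemma unimodal_not_le_iff: "\<not> s \<preceq> t \<longleftrightarrow> t \<prec> s"
proof (cases "s = t")
  case True
  then show ?thesis by (simp add: unimodal_le_def unimodal_less_def)
next
  case False
  then obtain r where r: "\<forall>i<r. s i = t i" "s r \<noteq> t r" by (rule first_difference)
  have "word_sign s r = word_sign t r" using r by (intro word_sign_cong) auto
  then have "word_sign t (Suc r) = - word_sign s (Suc r)"
    using symbol_sign_neq[OF r(2)] by simp
  moreover have "t \<prec> s \<longleftrightarrow> word_sign t (Suc r) = 1"
    using r by (intro unimodal_less_at) auto
  ultimately show ?thesis
    using False unimodal_less_at[OF r] word_sign_cases[of s "Suc r"]
    by (auto simp: unimodal_le_def)
qed

section \<open>Sequences with paired ones\<close>

definition pair_seq :: "(nat \<Rightarrow> nat) \<Rightarrow> bit word" where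
  "pair_seq p j = (if j = 0 \<or> (\<exists>i\<ge>1. j = p i \<or> j = p i + 1) then 1 else 0)"

text \<open>The factor of \<open>S\<close> on the half-open interval from \<open>u\<close> to \<open>v\<close> is a product of blocks \<open>0\<close> and
  \<open>11\<close>, with exactly \<open>n\<close> blocks \<open>11\<close>.\<close>

inductive pair_chain :: "(int \<Rightarrow> bit) \<Rightarrow> int \<Rightarrow> int \<Rightarrow> nat \<Rightarrow> bool" for S where
  empty: "pair_chain S u u 0"
| zero: "pair_chain S u v n \<Longrightarrow> S v = 0 \<Longrightarrow> pair_chain S u (v + 1) n"
| pair: "pair_chain S u v n \<Longrightarrow> S v = 1 \<Longrightarrow> S (v + 1) = 1 \<Longrightarrow> pair_chain S u (v + 2) (Suc n)"

lemma pair_chain_trans: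
  "pair_chain S v w m \<Longrightarrow> pair_chain S u v n \<Longrightarrow> pair_chain S u w (n + m)"
  by (induction rule: pair_chain.induct) (auto intro: pair_chain.intros)

lemma pair_chain_one_zero: "S u = 0 \<Longrightarrow> pair_chain S u (u + 1) 0"
  by (intro pair_chain.zero pair_chain.empty)

lemma pair_chain_zero_run:
  assumes "u \<le> v" "\<And>x. u \<le> x \<Longrightarrow> x < v \<Longrightarrow> S x = 0"
  shows "pair_chain S u v 0"
  using assms
proof (induction v rule: int_ge_induct)
  case base
  show ?case by (rule pair_chain.empty)
next
  case (step v)
  then show ?case by (intro pair_chain.zero) auto
qed

lemma pair_chain_mirror:
  assumes "pair_chain S u v n"
  shows "pair_chain (\<lambda>x. S (- 1 - x)) (- v) (- u) n"
  using assms
proof (induction rule: pair_chain.induct)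
  case (empty u)
  show ?case by (rule pair_chain.empty)
next
  case (zero u v n)
  have "pair_chain (\<lambda>x. S (- 1 - x)) (- (v + 1)) (- v) 0"
    using pair_chain_one_zero[of "\<lambda>x. S (- 1 - x)" "- (v + 1)"] zero by simp
  from pair_chain_trans[OF zero.IH this] show ?case by simp
next
  case (pair u v n)
  have "pair_chain (\<lambda>x. S (- 1 - x)) (- (v + 2)) (- (v + 2) + 2) (Suc 0)"
    using pair by (intro pair_chain.pair pair_chain.empty) (auto simp: algebra_simps)
  then have "pair_chain (\<lambda>x. S (- 1 - x)) (- (v + 2)) (- v) 1" by simp
  from pair_chain_trans[OF pair.IH this] show ?case by simp
qed

text \<open>A chain can be cut around its \<open>j\<close>-th pair; conversely, every one in a chain belongs to some pair
  around which the chain can be cut. Together the two lemmas express that the block decomposition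
  determines all symbols of the chain.\<close>

lemma pair_chain_split:
  assumes "pair_chain S u v n" "1 \<le> j" "j \<le> n"
  shows "\<exists>t. pair_chain S u t (j - 1) \<and> S t = 1 \<and> S (t + 1) = 1 \<and> pair_chain S (t + 2) v (n - j)"
  using assms
proof (induction arbitrary: j rule: pair_chain.induct)
  case (empty u)
  then show ?case by simp
next
  case (zero u v n)
  then show ?case using pair_chain.zero by meson
next
  case (pair u v n)
  show ?case
  proof (cases "j = Suc n")
    case True
    then show ?thesis using pair pair_chain.empty by (intro exI[of _ v]) auto
  next
    case False
    then have "j \<le> n" using pair by simp
    then obtain t where t: "pair_chain S u t (j - 1)" "S t = 1" "S (t + 1) = 1"
      "pair_chain S (t + 2) v (n - j)" using pair by blast
    from t(4) have "pair_chain S (t + 2) (v + 2) (Suc (n - j))" using pair by (intro pair_chain.pair)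
    then show ?thesis using t \<open>j \<le> n\<close> by (intro exI[of _ t]) (simp add: Suc_diff_le)
  qed
qed

lemma pair_chain_one:
  assumes "pair_chain S u v n" "u \<le> x" "x < v" "S x = 1"
  shows "\<exists>j t. 1 \<le> j \<and> j \<le> n \<and> pair_chain S u t (j - 1) \<and> S t = 1 \<and> S (t + 1) = 1
           \<and> pair_chain S (t + 2) v (n - j) \<and> x \<in> {t, t + 1}"
  using assms
proof (induction rule: pair_chain.induct)
  case (empty u)
  then show ?case by simp
next
  case (zero u v n)
  have "x \<noteq> v" using zero by auto
  then have "x < v" using zero by simp
  then obtain j t where "1 \<le> j" "j \<le> n" "pair_chain S u t (j - 1)" "S t = 1" "S (t + 1) = 1"
     "pair_chain S (t + 2) v (n - j)" "x \<in> {t, t + 1}" using zero by blast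
  then show ?case using zero pair_chain.zero by meson
next
  case (pair u v n)
  show ?case
  proof (cases "x < v")
    case True
    then obtain j t where t: "1 \<le> j" "j \<le> n" "pair_chain S u t (j - 1)" "S t = 1" "S (t + 1) = 1"
      "pair_chain S (t + 2) v (n - j)" "x \<in> {t, t + 1}" using pair by blast
    then have "pair_chain S (t + 2) (v + 2) (Suc (n - j))" using pair by (intro pair_chain.pair)
    then show ?thesis using t by (intro exI[of _ j] exI[of _ t]) (auto simp add: Suc_diff_le)
  next
    case False
    then have "x \<in> {v, v + 1}" using pair by auto
    then show ?thesis using pair pair_chain.empty
      by (intro exI[of _ "Suc n"] exI[of _ v]) auto
  qed
qed

text \<open>Superadditivity and \<open>2 \<le> p 1\<close> force consecutive values of \<open>p\<close> to be at least two apart, so the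
  pairs of \<open>pair_seq p\<close> are disjoint and the initial one is followed by a zero.\<close>

locale superadditive_pairs =
  fixes p :: "nat \<Rightarrow> nat"
  assumes first: "2 \<le> p 1"
    and superadditive: "1 \<le> i \<Longrightarrow> 1 \<le> j \<Longrightarrow> p i + p j \<le> p (i + j)"
begin

lemma gap: "1 \<le> i \<Longrightarrow> p i + 2 \<le> p (i + 1)"
  using superadditive[of i 1] first by simp

lemma gap_less: "1 \<le> i \<Longrightarrow> i < j \<Longrightarrow> p i + 2 \<le> p j"
proof (induction j)
  case (Suc j)
  then show ?case using gap[of j] by (cases "i = j") auto
qed simp

lemma mono: "1 \<le> i \<Longrightarrow> i \<le> j \<Longrightarrow> p i \<le> p j"
  using gap_less[of i j] by (cases "i = j") auto

lemma less_imp_less: "1 \<le> i \<Longrightarrow> 1 \<le> j \<Longrightarrow> p i < p j \<Longrightarrow> i < j"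
  using gap_less by (metis add_leD1 leD linorder_neqE_nat order_less_irrefl)

lemma ge_2: "1 \<le> i \<Longrightarrow> 2 \<le> p i"
  using mono[of 1 i] first by simp

abbreviation \<kappa> :: "bit word" where "\<kappa> \<equiv> pair_seq p"

lemma kappa_0 [simp]: "\<kappa> 0 = 1"
  by (simp add: pair_seq_def)

lemma kappa_1: "\<kappa> 1 = 0"
  using ge_2 by (fastforce simp: pair_seq_def)

lemma kappa_before_first: "0 < x \<Longrightarrow> x < p 1 \<Longrightarrow> \<kappa> x = 0"
proof -
  assume "0 < x" "x < p 1"
  then have "\<not> (\<exists>i\<ge>1. x = p i \<or> x = p i + 1)" using mono[of 1] by force
  then show ?thesis using \<open>0 < x\<close> by (simp add: pair_seq_def)
qed

lemma kappa_between:
  assumes "1 \<le> i" "p i + 1 < x" "x < p (i + 1)"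
  shows "\<kappa> x = 0"
proof -
  have "x \<noteq> p k \<and> x \<noteq> p k + 1" if "1 \<le> k" for k
    using assms less_imp_less[of i k] less_imp_less[of k "i + 1"] that by auto
  then show ?thesis using assms by (auto simp: pair_seq_def)
qed

lemma kappa_p: "1 \<le> i \<Longrightarrow> \<kappa> (p i) = 1" and kappa_Suc_p: "1 \<le> i \<Longrightarrow> \<kappa> (Suc (p i)) = 1"
  by (auto simp: pair_seq_def)

text \<open>The initial one makes prefixes odd, and each pair restores this parity. Hence a prefix is even
  only when it has been cut between the two ones of a pair.\<close>

lemma word_sign_kappa: "word_sign \<kappa> (Suc m) = 1 \<longleftrightarrow> (\<exists>i\<ge>1. m = p i)"
proof (induction m)
  case 0
  then show ?case using ge_2 by fastforce
next
  case (Suc m)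
  have one: "\<kappa> (Suc m) = 1 \<longleftrightarrow> (\<exists>i\<ge>1. Suc m = p i) \<or> (\<exists>i\<ge>1. m = p i)"
    by (auto simp: pair_seq_def)
  have excl: "\<not> ((\<exists>i\<ge>1. Suc m = p i) \<and> (\<exists>i\<ge>1. m = p i))"
    using gap_less by (metis Suc_n_not_le_n add_2_eq_Suc' le_SucI lessI less_imp_less n_not_Suc_n)
  show ?case
    using Suc one excl word_sign_cases[of \<kappa> "Suc m"] by (cases "\<kappa> (Suc m)") auto
qed

lemma kappa_less_iff:
  "\<kappa> \<prec> s \<longleftrightarrow> (\<exists>i\<ge>1. (\<forall>x<p i. s x = \<kappa> x) \<and> s (p i) = 0)"
proof
  assume "\<kappa> \<prec> s"
  then obtain r where r: "\<forall>i<r. \<kappa> i = s i" "\<kappa> r \<noteq> s r" "word_sign \<kappa> (Suc r) = 1"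
    by (auto simp: unimodal_less_iff)
  then obtain i where i: "i \<ge> 1" "r = p i" by (auto simp: word_sign_kappa simp del: word_sign_Suc)
  have "\<kappa> r = 1" using i by (auto simp: pair_seq_def)
  then show "\<exists>i\<ge>1. (\<forall>x<p i. s x = \<kappa> x) \<and> s (p i) = 0"
    using r i by (metis bit_not_one_iff)
next
  assume "\<exists>i\<ge>1. (\<forall>x<p i. s x = \<kappa> x) \<and> s (p i) = 0"
  then obtain i where i: "i \<ge> 1" "\<forall>x<p i. s x = \<kappa> x" "s (p i) = 0" by blast
  have "\<kappa> (p i) = 1" using i by (auto simp: pair_seq_def)
  moreover have "word_sign \<kappa> (Suc (p i)) = 1" using i word_sign_kappa by blast
  ultimately show "\<kappa> \<prec> s"
    unfolding unimodal_less_iff using i by (intro exI[of _ "p i"]) auto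
qed

text \<open>In \<open>pair_seq p\<close> itself, the part between the leading one and the pair at \<open>p (n + 1)\<close> is a chain
  with \<open>n\<close> pairs of length \<open>p (n + 1) - 1\<close>. An overlong chain has room for at least one more symbol.\<close>

definition overlong_chain :: "(int \<Rightarrow> bit) \<Rightarrow> nat \<Rightarrow> bool" where
  "overlong_chain S n \<longleftrightarrow> (\<exists>u v. pair_chain S u v n \<and> int (p (n + 1)) \<le> v - u)"

lemma overlong_chain_mirror:
  assumes "overlong_chain S n"
  shows "overlong_chain (\<lambda>x. S (- 1 - x)) n"
proof -
  from assms obtain u v where "pair_chain S u v n" "int (p (n + 1)) \<le> v - u"
    by (auto simp: overlong_chain_def)
  then show ?thesis
    unfolding overlong_chain_def using pair_chain_mirror
    by (intro exI[of _ "- v"] exI[of _ "- u"]) auto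
qed

text \<open>A sequence exceeds \<open>\<kappa>\<close> by having a zero where the pair at \<open>p i\<close> should begin, and this zero
  prolongs the chain of the preceding \<open>i - 1\<close> pairs by the one symbol that makes it overlong.\<close>

lemma kappa_less_imp_overlong_chain:
  assumes "\<kappa> \<prec> (\<lambda>j. S (r + int j))"
  shows "\<exists>n. overlong_chain S n"
proof -
  from assms obtain i where i: "i \<ge> 1"
    and agree: "\<And>x. x < p i \<Longrightarrow> S (r + int x) = \<kappa> x" and last: "S (r + int (p i)) = 0"
    by (auto simp: kappa_less_iff)
  have zeros: "S x = 0" if "\<kappa> (nat (x - r)) = 0" "r \<le> x" "x < r + int (p i)" for x
    using agree[of "nat (x - r)"] that by simp
  have "pair_chain S (r + 1) (r + int (p (Suc k))) k" if "Suc k \<le> i" for k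
    using that
  proof (induction k)
    case 0
    show ?case
    proof (rule pair_chain_zero_run)
      show "r + 1 \<le> r + int (p (Suc 0))" using first by simp
      fix x assume x: "r + 1 \<le> x" "x < r + int (p (Suc 0))"
      have "p 1 \<le> p i" using mono[of 1 i] i by simp
      then show "S x = 0" using x kappa_before_first[of "nat (x - r)"] by (intro zeros) auto
    qed
  next
    case (Suc k)
    let ?t = "r + int (p (Suc k))"
    have less: "p (Suc k) + 2 \<le> p i" using gap_less[of "Suc k" i] Suc.prems by simp
    have "S ?t = 1" using agree[of "p (Suc k)"] less by (auto simp: pair_seq_def)
    moreover have "S (?t + 1) = 1"
      using agree[of "p (Suc k) + 1"] less by (auto simp: pair_seq_def algebra_simps)
    ultimately have 1: "pair_chain S (r + 1) (?t + 2) (Suc k)"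
      using Suc by (intro pair_chain.pair) auto
    have "pair_chain S (?t + 2) (r + int (p (Suc (Suc k)))) 0"
    proof (rule pair_chain_zero_run)
      show "?t + 2 \<le> r + int (p (Suc (Suc k)))" using gap[of "Suc k"] by simp
      fix x assume x: "?t + 2 \<le> x" "x < r + int (p (Suc (Suc k)))"
      have "p (Suc (Suc k)) \<le> p i"
        using mono[of "Suc (Suc k)" i] Suc.prems by simp
      then show "S x = 0" using x kappa_between[of "Suc k" "nat (x - r)"] by (intro zeros) auto
    qed
    from pair_chain_trans[OF this 1] show ?case by simp
  qed
  from this[of "i - 1"] have "pair_chain S (r + 1) (r + int (p i)) (i - 1)" using i by simp
  from pair_chain.zero[OF this last] show ?thesis
    using i unfolding overlong_chain_def
    by (intro exI[of _ "i - 1"] exI[of _ "r + 1"] exI[of _ "r + int (p i) + 1"]) auto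
qed

text \<open>The heart of the symmetry. The chain on either side of the \<open>j\<close>-th pair has fewer than \<open>n\<close> pairs
  and is therefore not overlong, which bounds the position of that pair from above and from below; by
  superadditivity the two bounds meet in \<open>p j\<close>.\<close>

lemma minimal_chain_agrees:
  assumes chain: "pair_chain S (r + 1) v n" and long: "int (p (n + 1)) \<le> v - (r + 1)"
    and one: "S r = 1" and minimal: "\<And>m. m < n \<Longrightarrow> \<not> overlong_chain S m"
  shows "\<kappa> \<prec> (\<lambda>j. S (r + int j))"
proof -
  have position: "t = r + int (p j)"
    if "1 \<le> j" "j \<le> n" "pair_chain S (r + 1) t (j - 1)" "pair_chain S (t + 2) v (n - j)" for j t
  proof -
    have "t - (r + 1) < int (p j)"
      using minimal[of "j - 1"] that by (fastforce simp: overlong_chain_def)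
    moreover have "v - (t + 2) < int (p (n - j + 1))"
      using minimal[of "n - j"] that by (fastforce simp: overlong_chain_def)
    moreover have "p j + p (n - j + 1) \<le> p (n + 1)"
      using superadditive[of j "n - j + 1"] that by simp
    ultimately show ?thesis using long by linarith
  qed
  have pairs: "S (r + int (p j)) = 1 \<and> S (r + int (p j) + 1) = 1" if "1 \<le> j" "j \<le> n" for j
    using pair_chain_split[OF chain that] position[OF that] by blast
  have ones: "\<exists>j. 1 \<le> j \<and> j \<le> n \<and> (x = r + int (p j) \<or> x = r + int (p j) + 1)"
    if x: "r + 1 \<le> x" "x < v" "S x = 1" for x
    using pair_chain_one[OF chain x] position by blast
  have "S (r + int x) = \<kappa> x" if x: "x < p (n + 1)" for x
  proof (cases "x = 0")
    case True
    then show ?thesis using one by simp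
  next
    case False
    have "S (r + int x) = 1 \<longleftrightarrow> (\<exists>j\<ge>1. x = p j \<or> x = p j + 1)"
    proof
      assume "S (r + int x) = 1"
      then show "\<exists>j\<ge>1. x = p j \<or> x = p j + 1"
        using ones[of "r + int x"] False x long by fastforce
    next
      assume "\<exists>j\<ge>1. x = p j \<or> x = p j + 1"
      then obtain j where j: "j \<ge> 1" "x = p j \<or> x = p j + 1" by blast
      then have "j \<le> n" using less_imp_less[of j "n + 1"] x by auto
      then show "S (r + int x) = 1" using pairs[of j] j by (auto simp: algebra_simps)
    qed
    then show ?thesis using False by (auto simp: pair_seq_def)
  qed
  moreover have "S (r + int (p (n + 1))) = 0"
  proof (rule ccontr)
    assume "S (r + int (p (n + 1))) \<noteq> 0"
    then obtain j where "1 \<le> j" "j \<le> n" "p (n + 1) = p j \<or> p (n + 1) = p j + 1"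
      using ones[of "r + int (p (n + 1))"] ge_2[of "n + 1"] long by fastforce
    then show False using gap_less[of j "n + 1"] by auto
  qed
  ultimately show ?thesis unfolding kappa_less_iff by (intro exI[of _ "n + 1"]) auto
qed

lemma overlong_chain_imp_kappa_less:
  assumes "overlong_chain S n" and left_ones: "\<And>r. \<exists>r'<r. S r' = 1"
  shows "\<exists>r. \<kappa> \<prec> (\<lambda>j. S (r + int j))"
proof -
  define m where "m = (LEAST n. overlong_chain S n)"
  have m: "overlong_chain S m" unfolding m_def using assms(1) by (rule LeastI)
  have minimal: "\<not> overlong_chain S k" if "k < m" for k
    using that not_less_Least m_def by blast
  obtain u v where uv: "pair_chain S u v m" "int (p (m + 1)) \<le> v - u"
    using m by (auto simp: overlong_chain_def)
  \<comment> \<open>The chain is prolonged to the left until it is preceded by a one.\<close>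
  obtain d where d: "S (u - 1 - int d) = 1" "\<And>e. e < d \<Longrightarrow> S (u - 1 - int e) \<noteq> 1"
  proof -
    obtain r' where r': "r' < u" "S r' = 1" using left_ones by blast
    define Q where "Q e \<longleftrightarrow> S (u - 1 - int e) = 1" for e
    have "Q (nat (u - 1 - r'))" using r' by (simp add: Q_def)
    then have "Q (LEAST e. Q e)" by (rule LeastI)
    moreover have "\<And>e. e < (LEAST e. Q e) \<Longrightarrow> \<not> Q e" by (rule not_less_Least)
    ultimately show ?thesis using that unfolding Q_def by blast
  qed
  let ?r = "u - 1 - int d"
  have "pair_chain S (?r + 1) u 0"
  proof (rule pair_chain_zero_run)
    fix x assume "?r + 1 \<le> x" "x < u"
    then show "S x = 0" using d(2)[of "nat (u - 1 - x)"] by simp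
  qed simp
  from pair_chain_trans[OF uv(1) this] have "pair_chain S (?r + 1) v m" by simp
  then have "\<kappa> \<prec> (\<lambda>j. S (?r + int j))"
    using uv(2) d minimal by (intro minimal_chain_agrees[of _ _ v m]) auto
  then show ?thesis by blast
qed

text \<open>If \<open>\<kappa>\<close> has period \<open>n\<close> then translation by \<open>2 n\<close>, the length of an even word, preserves the set
  of lengths of even prefixes, that is, the set of values of \<open>p\<close> up to a shift. So \<open>p\<close> grows
  by a fixed amount along multiples of some index.\<close>

lemma periodic_imp_additive:
  assumes per: "\<And>i. \<kappa> (i + n) = \<kappa> i" and "1 \<le> n"
  shows "\<exists>i\<ge>1. \<forall>t\<ge>1. p (t * i) + 1 = t * (p i + 1)"
proof -
  define L where "L = 2 * n"
  have half: "word_sign \<kappa> (m + n) = word_sign \<kappa> n * word_sign \<kappa> m" for m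
    by (induction m) (auto simp: per)
  have sign: "word_sign \<kappa> (m + L) = word_sign \<kappa> m" for m
    using half[of m] half[of "m + n"] word_sign_cases[of \<kappa> n] by (auto simp: L_def mult_2 add.assoc)
  define P where "P m \<longleftrightarrow> (\<exists>i\<ge>1. m = p i)" for m
  have shift: "P (m + L) \<longleftrightarrow> P m" for m
    using sign[of "Suc m"] word_sign_kappa[of m] word_sign_kappa[of "m + L"] by (simp add: P_def)
  have "Suc (L - 1) = L" using \<open>1 \<le> n\<close> by (simp add: L_def)
  moreover have "word_sign \<kappa> L = 1" using sign[of 0] by simp
  ultimately obtain i where i: "i \<ge> 1" "L - 1 = p i" using word_sign_kappa[of "L - 1"] by auto
  have L: "L = p i + 1" using i \<open>Suc (L - 1) = L\<close> by simp
  \<comment> \<open>Both sides enumerate the elements of \<open>P\<close> beyond \<open>p i\<close> in increasing order.\<close>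
  have translate: "p (i + Suc j) = p (Suc j) + L" for j
  proof (induction j)
    case 0
    obtain k where k: "k \<ge> 1" "p 1 + L = p k" using shift[of "p 1"] by (auto simp: P_def)
    have "i < k" using less_imp_less[of i k] i k L by simp
    then have "p (i + 1) \<le> p k" using mono[of "i + 1" k] by simp
    moreover obtain m where m: "p (i + 1) = m + L"
    proof
      show "p (i + 1) = (p (i + 1) - L) + L" using gap[OF i(1)] L by simp
    qed
    moreover have "P (p (i + 1))" by (auto simp: P_def)
    then have "P m" using shift m by simp
    then obtain k' where "k' \<ge> 1" "m = p k'" by (auto simp: P_def)
    then have "p 1 \<le> m" using mono[of 1 k'] by simp
    ultimately show ?case using k by simp
  next
    case (Suc j)
    obtain k where k: "k \<ge> 1" "p (Suc (Suc j)) + L = p k"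
      using shift[of "p (Suc (Suc j))"] by (auto simp: P_def)
    have "p (i + Suc j) < p k" using gap[of "Suc j"] Suc k by simp
    then have "i + Suc j < k" using less_imp_less[of "i + Suc j" k] k by simp
    then have 1: "p (i + Suc (Suc j)) \<le> p k"
      using mono[of "i + Suc (Suc j)" k] by simp
    have less: "p (Suc j) + L < p (i + Suc (Suc j))" using gap[of "i + Suc j"] Suc by simp
    obtain m where m: "p (i + Suc (Suc j)) = m + L" "p (Suc j) < m"
    proof
      show "p (i + Suc (Suc j)) = (p (i + Suc (Suc j)) - L) + L"
        using less by simp
      show "p (Suc j) < p (i + Suc (Suc j)) - L"
        using less by simp
    qed
    have "P (p (i + Suc (Suc j)))" by (auto simp: P_def)
    then have "P m" using shift m by simp
    then obtain k' where k': "k' \<ge> 1" "m = p k'" by (auto simp: P_def)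
    then have "Suc j < k'" using less_imp_less[of "Suc j" k'] m by simp
    then have "p (Suc (Suc j)) \<le> m"
      using mono[of "Suc (Suc j)" k'] k' by simp
    then show ?case using 1 k m by simp
  qed
  have "p (Suc t * i) + 1 = Suc t * (p i + 1)" for t
  proof (induction t)
    case (Suc t)
    have "p (Suc (Suc t) * i) = p (i + Suc (Suc t * i - 1))" using i by simp
    also have "\<dots> = p (Suc t * i) + L" using translate[of "Suc t * i - 1"] i by simp
    finally show ?case using Suc L by simp
  qed simp
  then have "\<forall>t\<ge>1. p (t * i) + 1 = t * (p i + 1)"
    by (metis One_nat_def Suc_le_D)
  then show ?thesis using i by blast
qed

text \<open>Were the prefix odd, its final one would not be the first one of a pair, and repeating the prefix
  would put its initial \<open>10\<close> right behind; the one of this \<open>10\<close> would belong to no pair.\<close>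

lemma periodic_prefix_even:
  assumes per: "\<And>i. \<kappa> (i + Suc j) = \<kappa> i" and "\<kappa> j = 1"
  shows "word_sign \<kappa> (Suc j) = 1"
proof -
  have next1: "\<kappa> (Suc (Suc j)) = 0" using per[of 1] kappa_1 by simp
  have "\<kappa> (Suc j) = 1" using per[of 0] by simp
  then obtain k where k: "k \<ge> 1" "Suc j = p k \<or> Suc j = p k + 1"
    unfolding pair_seq_def by (metis nat.distinct(1) zero_neq_one)
  have "Suc j \<noteq> p k" using next1 kappa_Suc_p[OF k(1)] by auto
  then have "j = p k" using k by simp
  then show ?thesis using word_sign_kappa k by blast
qed

lemma forward_iff_backward_bounded:
  assumes left_ones: "\<And>r. \<exists>r'<r. S r' = 1" and right_ones: "\<And>r. \<exists>r'>r. S r' = 1"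
  shows "(\<forall>r. forward (shift_pow r S) \<preceq> \<kappa>) \<longleftrightarrow> (\<forall>r. backward (shift_pow r S) \<preceq> \<kappa>)"
proof -
  let ?M = "\<lambda>x. S (- 1 - x)"
  have fwd: "forward (shift_pow r S) = (\<lambda>j. S (r + int j))" for r
    by (simp add: forward_def shift_pow_def add.commute)
  have bwd: "backward (shift_pow r S) = (\<lambda>j. ?M (- r + int j))" for r
    by (simp add: backward_def shift_pow_def algebra_simps)
  have mirror_ones: "\<exists>r'<r. ?M r' = 1" for r
  proof -
    obtain r' where "r' > - 1 - r" "S r' = 1" using right_ones by blast
    then show ?thesis by (intro exI[of _ "- 1 - r'"]) auto
  qed
  have "(\<exists>r. \<not> forward (shift_pow r S) \<preceq> \<kappa>) \<longleftrightarrow> (\<exists>n. overlong_chain S n)"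
    unfolding unimodal_not_le_iff fwd
    using kappa_less_imp_overlong_chain overlong_chain_imp_kappa_less[of S] left_ones by blast
  moreover have "(\<exists>r. \<not> backward (shift_pow r S) \<preceq> \<kappa>) \<longleftrightarrow> (\<exists>n. overlong_chain ?M n)"
    unfolding unimodal_not_le_iff bwd
    using kappa_less_imp_overlong_chain[of ?M] overlong_chain_imp_kappa_less[of ?M] mirror_ones
    by (metis minus_minus)
  moreover have "overlong_chain ?M n \<longleftrightarrow> overlong_chain S n" for n
    using overlong_chain_mirror[of S n] overlong_chain_mirror[of ?M n] by auto
  ultimately show ?thesis by blast
qed

text \<open>If \<open>S\<close> had a leftmost one, the backward sequence from there would be \<open>1\<close> followed by zeros,
  which is the largest sequence of all.\<close>

lemma left_ones_of_backward_bounded: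
  assumes bounded: "\<And>r. backward (shift_pow r S) \<preceq> \<kappa>" and "\<not> ends_in_zeros S"
  shows "\<exists>r'<r. S r' = 1"
proof (rule ccontr)
  assume no: "\<not> (\<exists>r'<r. S r' = 1)"
  have "infinite {j. forward S j = 1}" using assms(2) by (simp add: ends_in_zeros_def)
  then obtain j where "forward S j = 1" "j > nat r"
    by (metis (mono_tags, lifting) infinite_nat_iff_unbounded mem_Collect_eq)
  then have one: "S (int j) = 1" "int j \<ge> r" by (auto simp: forward_def)
  define Q where "Q e \<longleftrightarrow> S (r + int e) = 1" for e
  have "Q (nat (int j - r))" using one by (simp add: Q_def)
  then have Q: "Q (LEAST e. Q e)" by (rule LeastI)
  define e where "e = (LEAST e. Q e)"
  have e: "S (r + int e) = 1" using Q by (simp add: Q_def e_def)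
  have before: "S x = 0" if "x < r + int e" for x
  proof (cases "x < r")
    case True
    then show ?thesis using no by auto
  next
    case False
    then have "\<not> Q (nat (x - r))" using that not_less_Least[of "nat (x - r)" Q] e_def by simp
    then show ?thesis using False by (simp add: Q_def)
  qed
  let ?s = "backward (shift_pow (r + int e + 1) S)"
  have s: "?s x = (if x = 0 then 1 else 0)" for x
    using e before by (auto simp: backward_def shift_pow_def algebra_simps)
  have "\<kappa> x = (if x = 0 then 1 else 0)" if "x < p 1" for x
    using that kappa_before_first by auto
  then have "\<kappa> \<prec> ?s" unfolding kappa_less_iff using s first by (intro exI[of _ 1]) auto
  then show False using bounded unimodal_not_le_iff by blast
qed

end

section \<open>Tent maps as expanding maps\<close>

locale core_tent_map =
  fixes f :: "real \<Rightarrow> real" and a b c l :: real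
  assumes tent: "tent_map f a b c l" and slope_gt_1: "1 < l" and slope_lt_2: "l < 2"
begin

abbreviation \<kappa> :: "bit word" where "\<kappa> \<equiv> kneading_seq f a b c"

text \<open>Both symbols are allowed at \<open>c\<close>. In this weak form an itinerary only says on which branch the
  map is affine, which suffices for all metric arguments; ties at \<open>c\<close> matter only for \<open>codes\<close>.\<close>

definition on_side :: "bit \<Rightarrow> real \<Rightarrow> bool" where
  "on_side e y \<longleftrightarrow> 0 \<le> symbol_sign e * (c - y)"

definition tracks :: "(nat \<Rightarrow> real) \<Rightarrow> bit word \<Rightarrow> bool" where
  "tracks x s \<longleftrightarrow> (\<forall>i. x i \<in> {a..b} \<and> x (Suc i) = f (x i) \<and> on_side (s i) (x i))"

text \<open>Orbits of the two affine maps that extend the branches of \<open>f\<close> to the whole line, chosen by the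
  symbols of \<open>s\<close>. The points need neither lie in \<open>{a..b}\<close> nor on the side of \<open>c\<close> given by \<open>s\<close>.\<close>

definition branch_orbit :: "(nat \<Rightarrow> real) \<Rightarrow> bit word \<Rightarrow> bool" where
  "branch_orbit x s \<longleftrightarrow> (\<forall>i. x (Suc i) = b - l * (symbol_sign (s i) * (c - x i)))"

lemma ac: "a < c" and cb: "c < b" and f_c: "f c = b" and f_b: "f b = a"
  using tent by (auto simp: tent_map_def)

lemma f_in: "x \<in> {a..b} \<Longrightarrow> f x \<in> {a..b}"
  using tent unfolding tent_map_def by blast

lemma f_left: "a \<le> x \<Longrightarrow> x \<le> c \<Longrightarrow> f x = b - l * (c - x)"
proof -
  assume "a \<le> x" "x \<le> c"
  then have "f c - f x = l * (c - x)" using tent unfolding tent_map_def by fastforce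
  then show ?thesis using f_c by simp
qed

lemma f_right: "c \<le> x \<Longrightarrow> x \<le> b \<Longrightarrow> f x = b - l * (x - c)"
proof -
  assume "c \<le> x" "x \<le> b"
  then have "f x - f c = - l * (x - c)" using tent unfolding tent_map_def by fastforce
  then show ?thesis using f_c by simp
qed

lemma f_on_side:
  assumes "x \<in> {a..b}" "on_side e x"
  shows "f x = b - l * (symbol_sign e * (c - x))"
  using assms f_left[of x] f_right[of x]
  by (cases e) (auto simp: on_side_def algebra_simps)

lemma a_eq: "a = b - l * (b - c)"
  using f_right[of b] f_b cb by simp

lemma f_eq_b: "x \<in> {a..b} \<Longrightarrow> f x = b \<longleftrightarrow> x = c"
  using f_left[of x] f_right[of x] f_c slope_gt_1 by (cases "x \<le> c") auto

text \<open>On the left branch every point moves to the right by at least this positive amount, so no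
  orbit stays on the left branch forever, forwards or backwards.\<close>

lemma f_left_moves: "a \<le> x \<Longrightarrow> x \<le> c \<Longrightarrow> x + (f a - a) \<le> f x"
proof -
  assume x: "a \<le> x" "x \<le> c"
  have "f x = f a + l * (x - a)"
    using f_left[of x] f_left[of a] x ac by (simp add: algebra_simps)
  moreover have "1 * (x - a) \<le> l * (x - a)" using slope_gt_1 x by (intro mult_right_mono) auto
  ultimately show ?thesis by simp
qed

lemma f_a_gt: "a < f a"
proof -
  have "f a - a = l * (b - c) - l * (c - a)"
    using f_left[of a] ac a_eq by simp
  also have "c - a = (l - 1) * (b - c)" using a_eq by (simp add: algebra_simps)
  also have "l * (b - c) - l * ((l - 1) * (b - c)) = l * (2 - l) * (b - c)"
    by (simp add: algebra_simps)
  finally have "f a - a = l * (2 - l) * (b - c)" .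
  then show ?thesis using slope_gt_1 slope_lt_2 cb by (smt (verit) mult_pos_pos)
qed

lemma funpow_in: "x \<in> {a..b} \<Longrightarrow> (f ^^ n) x \<in> {a..b}"
  by (induction n) (use f_in in auto)

lemma tracks_branch_orbit: "tracks x s \<Longrightarrow> branch_orbit x s"
  using f_on_side by (simp add: tracks_def branch_orbit_def)

lemma branch_orbit_expands:
  assumes "branch_orbit x s" "branch_orbit y t" "\<And>i. i < r \<Longrightarrow> s i = t i"
  shows "x r - y r = l ^ r * (word_sign s r * (x 0 - y 0))"
  using assms(3)
proof (induction r)
  case (Suc r)
  have "x (Suc r) = b - l * (symbol_sign (s r) * (c - x r))"
    using assms(1) by (simp add: branch_orbit_def)
  moreover have "y (Suc r) = b - l * (symbol_sign (s r) * (c - y r))"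
    using assms(2) Suc.prems[of r] by (simp add: branch_orbit_def)
  ultimately have "x (Suc r) - y (Suc r) = l * symbol_sign (s r) * (x r - y r)"
    by (simp add: algebra_simps)
  then show ?case using Suc by (simp add: algebra_simps)
qed simp

text \<open>Two orbits along the same branches separate by the factor \<open>l\<close> in each step.\<close>

lemma branch_orbit_unique:
  assumes "branch_orbit x s" "branch_orbit y s" "\<And>i. \<bar>x i - y i\<bar> \<le> B"
  shows "x 0 = y 0"
proof (rule ccontr)
  assume neq: "x 0 \<noteq> y 0"
  obtain n where n: "B / \<bar>x 0 - y 0\<bar> < l ^ n" using real_arch_pow[OF slope_gt_1] by blast
  have "\<bar>x n - y n\<bar> = l ^ n * \<bar>x 0 - y 0\<bar>"
    using branch_orbit_expands[OF assms(1,2), of n] slope_gt_1 by (simp add: abs_mult)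
  moreover have "B < l ^ n * \<bar>x 0 - y 0\<bar>" using n neq by (simp add: divide_less_eq)
  ultimately show False using assms(3)[of n] by simp
qed

lemma tracks_unique:
  assumes "tracks x s" "tracks y s"
  shows "x 0 = y 0"
proof (rule branch_orbit_unique[OF assms[THEN tracks_branch_orbit]])
  fix i
  have "x i \<in> {a..b}" "y i \<in> {a..b}" using assms by (simp_all add: tracks_def)
  then show "\<bar>x i - y i\<bar> \<le> b - a" by auto
qed

text \<open>At the first difference the sign of the common prefix equals the sign of \<open>s r\<close>, so the order of
  the starting points is decided by the side on which \<open>x r\<close> lies.\<close>

lemma pull_back_difference:
  assumes "branch_orbit x s" "branch_orbit y t"
    and "\<forall>i<r. s i = t i" "s r \<noteq> t r" "word_sign s (Suc r) = 1" "on_side (t r) (y r)"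
  shows "l ^ r * (x 0 - y 0) \<le> - (symbol_sign (s r) * (c - x r))"
proof -
  have sgn: "word_sign s r = symbol_sign (s r)"
    using assms(5) symbol_sign_cases[of "s r"] word_sign_cases[of s r] by auto
  have "l ^ r * (x 0 - y 0) = symbol_sign (s r) * (x r - y r)"
    using branch_orbit_expands[OF assms(1,2), of r] assms(3) sgn symbol_sign_cases[of "s r"] by auto
  also have "\<dots> = - (symbol_sign (s r) * (c - x r)) - symbol_sign (t r) * (c - y r)"
    using symbol_sign_neq[OF assms(4)] by (simp add: algebra_simps)
  finally show ?thesis using assms(6) by (simp add: on_side_def)
qed

lemma tracks_mono:
  assumes "tracks x s" "tracks y t" "s \<prec> t"
  shows "x 0 \<le> y 0"
proof -
  from assms(3) obtain r where r: "\<forall>i<r. s i = t i" "s r \<noteq> t r" "word_sign s (Suc r) = 1"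
    by (auto simp: unimodal_less_iff)
  have side: "on_side (s r) (x r)" "on_side (t r) (y r)" using assms by (auto simp: tracks_def)
  have "l ^ r * (x 0 - y 0) \<le> - (symbol_sign (s r) * (c - x r))"
    using pull_back_difference assms(1,2)[THEN tracks_branch_orbit] r side(2) by blast
  also have "\<dots> \<le> 0" using side(1) by (simp add: on_side_def)
  finally have "l ^ r * (x 0 - y 0) \<le> 0" .
  moreover have "0 < l ^ r" using slope_gt_1 by simp
  ultimately show ?thesis by (simp add: mult_le_0_iff)
qed

subsection \<open>The kneading sequence\<close>

lemma codes_on_side: "codes f a b c y e \<Longrightarrow> y \<in> {a..b} \<Longrightarrow> on_side e y"
  by (cases e) (auto simp: codes_def on_side_def split: if_splits)

lemma codes_iff_on_side:
  "\<not> periodic_pt f c \<Longrightarrow> y \<in> {a..b} \<Longrightarrow> codes f a b c y e \<longleftrightarrow> on_side e y"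
  by (cases e) (auto simp: codes_def on_side_def)

lemma codes_unique:
  assumes "periodic_pt f c \<or> y \<noteq> c" "codes f a b c y e" "codes f a b c y e'"
  shows "e = e'"
  using assms by (cases e; cases e') (auto simp: codes_def split: if_splits)

lemma codes_exists: "y \<in> {a..b} \<Longrightarrow> \<exists>e. codes f a b c y e"
proof (cases "periodic_pt f c")
  case False
  assume "y \<in> {a..b}"
  then show ?thesis
    using False by (intro exI[of _ "if y \<le> c then 0 else 1"]) (auto simp: codes_def)
qed (auto simp: codes_def)

lemma funpow_b: "(f ^^ r) b = (f ^^ Suc r) c"
  using f_c by (simp only: funpow_Suc_right comp_apply)

lemma funpow_b_eq_c: "(f ^^ r) b = c \<Longrightarrow> periodic_pt f c"
  unfolding funpow_b periodic_pt_def by (metis One_nat_def Suc_le_mono le0)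

lemma itinerary_b_unique:
  "is_itinerary f a b c b s \<Longrightarrow> is_itinerary f a b c b t \<Longrightarrow> s = t"
  using codes_unique funpow_b_eq_c unfolding is_itinerary_def by blast

lemma itinerary_kneading: "is_itinerary f a b c b \<kappa>"
proof -
  have "\<forall>r. \<exists>e. codes f a b c ((f ^^ r) b) e"
    using funpow_in[of b] codes_exists ac cb by auto
  then have "\<exists>s. is_itinerary f a b c b s" unfolding is_itinerary_def by metis
  then show ?thesis unfolding kneading_seq_def using itinerary_b_unique by (metis the_equality)
qed

lemma tracks_kneading: "tracks (\<lambda>i. (f ^^ i) b) \<kappa>"
  using itinerary_kneading funpow_in[of b] codes_on_side ac cb
  by (auto simp: tracks_def is_itinerary_def)

lemma on_side_unique: "on_side e y \<Longrightarrow> on_side e' y \<Longrightarrow> y \<noteq> c \<Longrightarrow> e = e'"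
  by (cases e; cases e') (auto simp: on_side_def)

text \<open>A weak itinerary of \<open>b\<close> can deviate from \<open>\<kappa>\<close> only when the orbit passes through \<open>c\<close>.\<close>

lemma tracks_b_first_difference:
  assumes "tracks x s" "x 0 = b" "\<forall>i<r. s i = \<kappa> i" "s r \<noteq> \<kappa> r"
  shows "(f ^^ r) b = c"
proof -
  have "x r = (f ^^ r) b"
    using branch_orbit_expands[OF tracks_branch_orbit[OF assms(1)] tracks_branch_orbit[OF tracks_kneading], of r]
      assms(2,3) by auto
  moreover have "on_side (s r) (x r)" "on_side (\<kappa> r) ((f ^^ r) b)"
    using assms(1) tracks_kneading by (auto simp: tracks_def)
  ultimately show ?thesis using on_side_unique assms(4) by metis
qed

lemma kneading_shift_eq:
  assumes "(f ^^ n) b = b"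
  shows "\<kappa> (i + n) = \<kappa> i"
proof -
  have "is_itinerary f a b c b (\<lambda>i. \<kappa> (i + n))"
    using itinerary_kneading assms unfolding is_itinerary_def by (metis funpow_add comp_apply)
  then show ?thesis using itinerary_b_unique[OF itinerary_kneading] by metis
qed

text \<open>Along a period of \<open>\<kappa>\<close> the point \<open>b\<close> returns to itself by uniqueness, and the only way into
  \<open>b\<close> leads through \<open>c\<close>. The last symbol of the period is thus the symbol given to \<open>c\<close>.\<close>

lemma kneading_periodic:
  assumes "\<And>i. \<kappa> (i + Suc n) = \<kappa> i"
  shows "periodic_pt f c" "turning_symbol f b c = \<kappa> n"
proof -
  have "tracks (\<lambda>i. (f ^^ (i + Suc n)) b) \<kappa>"
    using tracks_kneading assms unfolding tracks_def by (metis add_Suc)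
  from tracks_unique[OF this tracks_kneading] have "f ((f ^^ n) b) = b" by simp
  then have fn: "(f ^^ n) b = c" using f_eq_b funpow_in[of b n] ac cb by auto
  then show per: "periodic_pt f c" by (rule funpow_b_eq_c)
  have "codes f a b c c (\<kappa> n)"
    using itinerary_kneading fn unfolding is_itinerary_def by metis
  then show "turning_symbol f b c = \<kappa> n" using per by (auto simp: codes_def)
qed

lemma periodic_imp_kneading_periodic:
  assumes "periodic_pt f c"
  obtains n where "n \<ge> 1" "\<And>i. \<kappa> (i + n) = \<kappa> i"
proof -
  obtain n where n: "n \<ge> 1" "(f ^^ n) c = c" using assms by (auto simp: periodic_pt_def)
  have "(f ^^ n) b = f ((f ^^ n) c)" using funpow_b by simp
  then have "(f ^^ n) b = b" using n f_c by simp
  then show ?thesis using that n kneading_shift_eq by blast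
qed

subsection \<open>Forward admissibility\<close>

text \<open>No point of the interval lies beyond \<open>b\<close>, and the order of points reflects that of weak
  itineraries. The endpoint itself is excluded because its weak itineraries may exceed \<open>\<kappa>\<close> when
  \<open>c\<close> is periodic.\<close>

lemma tracks_le_kneading:
  assumes "tracks x s" "x 0 \<noteq> b"
  shows "s \<preceq> \<kappa>"
proof (rule ccontr)
  assume "\<not> s \<preceq> \<kappa>"
  then have "b \<le> x 0" using tracks_mono[OF tracks_kneading assms(1)] by (simp add: unimodal_not_le_iff)
  moreover have "x 0 \<le> b" using assms(1) by (simp add: tracks_def)
  ultimately show False using assms(2) by simp
qed

text \<open>The weak form of the itineraries of points of the inverse limit.\<close>

definition bi_tracks :: "(int \<Rightarrow> real) \<Rightarrow> (int \<Rightarrow> bit) \<Rightarrow> bool" where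
  "bi_tracks x S \<longleftrightarrow> x \<in> inverse_limit f a b \<and> (\<forall>r. on_side (S r) (x r))"

lemma forward_shift: "forward (shift_pow r S) j = S (r + int j)"
  by (simp add: forward_def shift_pow_def add.commute)

lemma bi_tracks_tracks:
  "bi_tracks x S \<Longrightarrow> tracks (\<lambda>i. x (r + int i)) (forward (shift_pow r S))"
  by (simp add: bi_tracks_def tracks_def inverse_limit_def forward_shift add_ac)

lemma itinerary_bi_tracks:
  "x \<in> inverse_limit f a b \<Longrightarrow> is_inverse_limit_itinerary f a b c x S \<Longrightarrow> bi_tracks x S"
  using codes_on_side by (auto simp: bi_tracks_def is_inverse_limit_itinerary_def inverse_limit_def)

lemma itinerary_forward_of_b:
  assumes "x \<in> inverse_limit f a b" "is_inverse_limit_itinerary f a b c x S" "x r = b"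
  shows "forward (shift_pow r S) = \<kappa>"
proof -
  have x: "x (r + int i) = (f ^^ i) b" for i
  proof (induction i)
    case (Suc i)
    have "x (r + int (Suc i)) = f (x (r + int i))"
      using assms(1) by (simp add: inverse_limit_def add_ac)
    then show ?case using Suc by simp
  qed (use assms in simp)
  have "is_itinerary f a b c b (forward (shift_pow r S))"
    using assms(2) x unfolding is_itinerary_def is_inverse_limit_itinerary_def
    by (metis forward_shift)
  then show ?thesis using itinerary_b_unique itinerary_kneading by blast
qed

lemma itinerary_forward_le:
  assumes "x \<in> inverse_limit f a b" "is_inverse_limit_itinerary f a b c x S"
  shows "forward (shift_pow r S) \<preceq> \<kappa>"
proof (cases "x r = b")
  case True
  then show ?thesis using itinerary_forward_of_b[OF assms] by (simp add: unimodal_le_def)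
next
  case False
  then show ?thesis
    using tracks_le_kneading[OF bi_tracks_tracks[OF itinerary_bi_tracks[OF assms], of r]] by simp
qed

lemma zeros_move_right:
  assumes "bi_tracks x S" "\<And>i. i < n \<Longrightarrow> S (r + int i) = 0"
  shows "x r + real n * (f a - a) \<le> x (r + int n)"
  using assms(2)
proof (induction n)
  case (Suc n)
  have "on_side 0 (x (r + int n))"
    using assms(1) Suc.prems[of n] unfolding bi_tracks_def by (metis lessI)
  then have "x (r + int n) \<in> {a..c}"
    using assms(1) by (simp add: bi_tracks_def inverse_limit_def on_side_def)
  then have "x (r + int n) + (f a - a) \<le> f (x (r + int n))" using f_left_moves by auto
  also have "\<dots> = x (r + int (Suc n))"
    using assms(1) by (simp add: bi_tracks_def inverse_limit_def add_ac)
  finally show ?case using Suc by (simp add: algebra_simps)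
qed simp

lemma bi_tracks_zero_run_bounded:
  assumes "bi_tracks x S"
  obtains N where "\<And>r. \<exists>i<N. S (r + int i) = 1"
proof -
  obtain N where N: "b - a < real N * (f a - a)"
    using reals_Archimedean3 f_a_gt by (metis diff_gt_0_iff_gt)
  show ?thesis
  proof (rule that[of N], rule ccontr)
    fix r assume "\<not> (\<exists>i<N. S (r + int i) = 1)"
    then have "x r + real N * (f a - a) \<le> x (r + int N)"
      by (intro zeros_move_right[OF assms]) auto
    moreover have "x r \<in> {a..b}" "x (r + int N) \<in> {a..b}"
      using assms by (auto simp: bi_tracks_def inverse_limit_def)
    ultimately show False using N by auto
  qed
qed

lemma bi_tracks_left_ones: "bi_tracks x S \<Longrightarrow> \<exists>r'<r. S r' = 1"
proof -
  assume "bi_tracks x S"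
  then obtain N where N: "\<And>r. \<exists>i<N. S (r + int i) = 1" by (rule bi_tracks_zero_run_bounded) auto
  from N[of "r - int N"] obtain i where "i < N" "S (r - int N + int i) = 1" by blast
  then show ?thesis by (intro exI[of _ "r - int N + int i"]) auto
qed

lemma bi_tracks_right_ones: "bi_tracks x S \<Longrightarrow> \<exists>r'>r. S r' = 1"
proof -
  assume "bi_tracks x S"
  then obtain N where N: "\<And>r. \<exists>i<N. S (r + int i) = 1" by (rule bi_tracks_zero_run_bounded) auto
  from N[of "r + 1"] obtain i where "i < N" "S (r + 1 + int i) = 1" by blast
  then show ?thesis by (intro exI[of _ "r + 1 + int i"]) auto
qed

subsection \<open>Realising admissible sequences\<close>

text \<open>Solving \<open>x (i + 1) = b - l * (symbol_sign (s i) * (c - x i))\<close> for \<open>x i\<close> gives a contraction in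
  \<open>x (i + 1)\<close>;
  the series is its iteration, and it defines the bounded orbit along the branches \<open>s\<close> for every
  sequence \<open>s\<close>, admissible or not. Admissibility enters only to keep this orbit inside \<open>{a..b}\<close>.\<close>

definition coded_point :: "bit word \<Rightarrow> real" where
  "coded_point s = b - (b - c) * (\<Sum>k. word_sign s k * (1 / l) ^ k)"

lemma word_sign_series_summable: "summable (\<lambda>k. word_sign s k * (1 / l) ^ k)"
proof (rule summable_comparison_test)
  show "summable (\<lambda>k. (1 / l) ^ k)" using slope_gt_1 by (intro summable_geometric) auto
  show "\<exists>N. \<forall>n\<ge>N. norm (word_sign s n * (1 / l) ^ n) \<le> (1 / l) ^ n"
    using slope_gt_1 by (auto simp: abs_mult)
qed

lemma coded_point_bounded: "\<bar>coded_point s - b\<bar> \<le> (b - c) * (\<Sum>k. (1 / l) ^ k)"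
proof -
  have norm: "norm (word_sign s k * (1 / l) ^ k) = (1 / l) ^ k" for k
    using slope_gt_1 by (simp add: abs_mult)
  have "norm (\<Sum>k. word_sign s k * (1 / l) ^ k) \<le> (\<Sum>k. norm (word_sign s k * (1 / l) ^ k))"
  proof (rule summable_norm)
    show "summable (\<lambda>k. norm (word_sign s k * (1 / l) ^ k))"
      unfolding norm using slope_gt_1 by (intro summable_geometric) auto
  qed
  then have "\<bar>\<Sum>k. word_sign s k * (1 / l) ^ k\<bar> \<le> (\<Sum>k. (1 / l) ^ k)" unfolding norm by simp
  then have "(b - c) * \<bar>\<Sum>k. word_sign s k * (1 / l) ^ k\<bar> \<le> (b - c) * (\<Sum>k. (1 / l) ^ k)"
    using cb by (intro mult_left_mono) auto
  then show ?thesis unfolding coded_point_def using cb by (simp add: abs_mult)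
qed

lemma word_sign_shift:
  "word_sign s (Suc k) = symbol_sign (s 0) * word_sign (\<lambda>i. s (Suc i)) k"
  unfolding word_sign_def by (rule prod.lessThan_Suc_shift)

lemma coded_point_step:
  "coded_point (\<lambda>i. s (Suc i)) = b - l * (symbol_sign (s 0) * (c - coded_point s))"
proof -
  let ?t = "\<lambda>i. s (Suc i)"
  let ?A = "\<Sum>k. word_sign s k * (1 / l) ^ k"
  let ?B = "\<Sum>k. word_sign ?t k * (1 / l) ^ k"
  have "(\<Sum>k. word_sign s (Suc k) * (1 / l) ^ Suc k) = ?A - 1"
    using suminf_split_head[OF word_sign_series_summable[of s]] by simp
  moreover have "(\<Sum>k. word_sign s (Suc k) * (1 / l) ^ Suc k) =
      (\<Sum>k. symbol_sign (s 0) / l * (word_sign ?t k * (1 / l) ^ k))"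
    unfolding word_sign_shift by (simp add: mult_ac)
  moreover have "\<dots> = symbol_sign (s 0) / l * ?B"
    by (rule suminf_mult[OF word_sign_series_summable])
  ultimately have "?A = 1 + symbol_sign (s 0) / l * ?B" by simp
  then have "c - coded_point s = (b - c) * (symbol_sign (s 0) / l * ?B)"
    unfolding coded_point_def by (simp add: algebra_simps)
  moreover have "l * (e * (d * (e / l * B))) = e * e * (d * B)" for e d B
    using slope_gt_1 by (simp add: field_simps)
  ultimately have "l * (symbol_sign (s 0) * (c - coded_point s)) = (b - c) * ?B"
    by (metis mult_1 symbol_sign_square)
  then show ?thesis unfolding coded_point_def[of ?t] by simp
qed

lemma coded_point_orbit: "branch_orbit (\<lambda>i. coded_point (\<lambda>j. s (i + j))) s"
  unfolding branch_orbit_def using coded_point_step[of "\<lambda>j. s (_ + j)"] by simp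

lemma coded_point_kneading: "coded_point \<kappa> = b"
proof -
  let ?B = "(b - c) * (\<Sum>k. (1 / l) ^ k)"
  have "\<bar>coded_point (\<lambda>j. \<kappa> (i + j)) - (f ^^ i) b\<bar> \<le> ?B + (b - a)" for i
    using coded_point_bounded[of "\<lambda>j. \<kappa> (i + j)"] funpow_in[of b i] ac cb by (auto simp: abs_le_iff)
  from branch_orbit_unique[OF coded_point_orbit tracks_branch_orbit[OF tracks_kneading] this]
  show ?thesis by simp
qed

text \<open>Compare the orbit of \<open>coded_point s\<close> with that of \<open>b\<close>. Where the symbols first differ, the wrong
  symbol of \<open>s\<close> can place the coded point at most \<open>B / l\<close> on the wrong side of \<open>c\<close>, since its
  image exceeds \<open>b\<close> by at most \<open>B\<close>; pulling back only shrinks this amount.\<close>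

lemma excess_contracts:
  assumes adm: "s \<preceq> \<kappa>" and "0 \<le> B" and le: "\<And>i. coded_point (\<lambda>j. s (i + j)) \<le> b + B"
  shows "coded_point s \<le> b + B / l"
proof (cases "coded_point s \<le> b")
  case True
  then show ?thesis using \<open>0 \<le> B\<close> slope_gt_1 by (smt (verit) divide_nonneg_pos)
next
  case False
  then have "s \<prec> \<kappa>" using adm coded_point_kneading by (auto simp: unimodal_le_def)
  then obtain r where r: "\<forall>i<r. s i = \<kappa> i" "s r \<noteq> \<kappa> r" "word_sign s (Suc r) = 1"
    by (auto simp: unimodal_less_iff)
  let ?x = "\<lambda>i. coded_point (\<lambda>j. s (i + j))"
  have "1 * (?x 0 - b) \<le> l ^ r * (?x 0 - b)"
    using False slope_gt_1 by (intro mult_right_mono) auto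
  also have "\<dots> \<le> - (symbol_sign (s r) * (c - ?x r))"
    using pull_back_difference[OF coded_point_orbit tracks_branch_orbit[OF tracks_kneading] r]
      tracks_kneading by (simp add: tracks_def)
  also have "\<dots> = (?x (Suc r) - b) / l"
    using coded_point_orbit[of s] slope_gt_1 by (simp add: branch_orbit_def)
  also have "\<dots> \<le> B / l" using le[of "Suc r"] slope_gt_1 by (intro divide_right_mono) auto
  finally show ?thesis by simp
qed

text \<open>By \<open>excess_contracts\<close> the points of the sequence cannot exceed \<open>b\<close>. The lower bound follows
  from the ones on the left: the image of a point of \<open>{c..b}\<close> under the right branch is at least
  \<open>a\<close>, and from then on the orbit stays in the interval.\<close>

lemma admissible_bi_tracks:
  assumes adm: "\<And>r. forward (shift_pow r S) \<preceq> \<kappa>" and left_ones: "\<And>r. \<exists>r'<r. S r' = 1"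
  shows "\<exists>x. bi_tracks x S"
proof -
  define x where "x r = coded_point (forward (shift_pow r S))" for r
  have tail: "coded_point (\<lambda>j. forward (shift_pow r S) (i + j)) = x (r + int i)" for r i
    unfolding x_def by (rule arg_cong[where f = coded_point]) (simp add: fun_eq_iff forward_shift add_ac)
  have step: "x (r + 1) = b - l * (symbol_sign (S r) * (c - x r))" for r
    using coded_point_orbit[of "forward (shift_pow r S)"] tail[of r 0] tail[of r 1]
    unfolding branch_orbit_def by (metis One_nat_def add.right_neutral forward_shift of_nat_0 of_nat_1)
  define B where "B = (b - c) * (\<Sum>k. (1 / l) ^ k)"
  have bounded: "\<bar>x r - b\<bar> \<le> B" for r unfolding x_def B_def by (rule coded_point_bounded)
  have B: "0 \<le> B" "x r \<le> b + B" for r using bounded[of r] by auto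
  have iterated: "x r \<le> b + B / l ^ n" for r n
  proof (induction n arbitrary: r)
    case (Suc n)
    have "x r \<le> b + (B / l ^ n) / l"
      unfolding x_def using Suc.IH B(1) slope_gt_1
      by (intro excess_contracts[OF adm]) (auto simp: tail)
    then show ?case by (simp add: mult.commute)
  qed (use B in simp)
  have upper: "x r \<le> b" for r
  proof (rule ccontr)
    assume "\<not> x r \<le> b"
    then have pos: "0 < x r - b" by simp
    obtain n where "B / (x r - b) < l ^ n" using real_arch_pow[OF slope_gt_1] by blast
    then have "B / l ^ n < x r - b" using pos slope_gt_1 by (simp add: field_simps)
    then show False using iterated[of r n] by simp
  qed
  \<comment> \<open>Each affine branch maps the points on its wrong side of \<open>c\<close> beyond \<open>b\<close>.\<close>
  have side: "on_side (S r) (x r)" for r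
    unfolding on_side_def using upper[of "r + 1"] step[of r] slope_gt_1 by (simp add: zero_le_mult_iff)
  have lower: "a \<le> x r" for r
  proof -
    obtain r' where r': "r' < r" "S r' = 1" using left_ones by blast
    have "a \<le> x (r' + 1 + int i)" for i
    proof (induction i)
      case 0
      have "l * (x r' - c) \<le> l * (b - c)"
        using upper[of r'] slope_gt_1 by (intro mult_left_mono) auto
      then show ?case using step[of r'] r' a_eq by (simp add: algebra_simps)
    next
      case (Suc i)
      let ?y = "x (r' + 1 + int i)"
      have "?y \<in> {a..b}" using Suc upper by simp
      then have "f ?y = x (r' + 1 + int i + 1)" using f_on_side[OF _ side] step[of "r' + 1 + int i"] by metis
      then show ?case using f_in[OF \<open>?y \<in> {a..b}\<close>] by (simp add: add_ac)
    qed
    from this[of "nat (r - r' - 1)"] show ?thesis using r' by simp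
  qed
  have "x r \<in> {a..b} \<and> f (x r) = x (r + 1)" for r
    using upper lower f_on_side[OF _ side] step by simp
  then have "x \<in> inverse_limit f a b" by (simp add: inverse_limit_def)
  then show ?thesis using side unfolding bi_tracks_def by blast
qed

theorem itinerary_iff_forward_nonperiodic:
  assumes "\<not> periodic_pt f c"
  shows "S \<in> inverse_limit_itineraries f a b c \<longleftrightarrow>
    (\<forall>r. forward (shift_pow r S) \<preceq> \<kappa>) \<and> (\<forall>r. \<exists>r'<r. S r' = 1) \<and> (\<forall>r. \<exists>r'>r. S r' = 1)"
    (is "?L \<longleftrightarrow> ?R")
proof
  assume ?L
  then obtain x where x: "x \<in> inverse_limit f a b" "is_inverse_limit_itinerary f a b c x S"
    by (auto simp: inverse_limit_itineraries_def)
  then show ?R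
    using itinerary_forward_le[OF x] itinerary_bi_tracks[OF x]
      bi_tracks_left_ones bi_tracks_right_ones by blast
next
  assume ?R
  then obtain x where "bi_tracks x S" using admissible_bi_tracks by blast
  then show ?L
    using codes_iff_on_side[OF assms]
    unfolding inverse_limit_itineraries_def is_inverse_limit_itinerary_def bi_tracks_def
      inverse_limit_def by blast
qed

text \<open>Each visit to \<open>c\<close> must be coded by the turning symbol \<open>1\<close>. Such a visit is followed by
  \<open>b\<close>, so it suffices to see that an admissible weak itinerary of \<open>b\<close> is \<open>\<kappa>\<close> itself: it could deviate
  only at a later visit to \<open>c\<close>, and since the prefix of \<open>\<kappa>\<close> ending there is even, it would
  exceed \<open>\<kappa>\<close>.\<close>

theorem itinerary_iff_forward_periodic:
  assumes per: "periodic_pt f c" and turn: "turning_symbol f b c = 1"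
    and even: "\<And>j. (f ^^ j) b = c \<Longrightarrow> word_sign \<kappa> (Suc j) = 1"
  shows "S \<in> inverse_limit_itineraries f a b c \<longleftrightarrow>
    (\<forall>r. forward (shift_pow r S) \<preceq> \<kappa>) \<and> (\<forall>r. \<exists>r'<r. S r' = 1) \<and> (\<forall>r. \<exists>r'>r. S r' = 1) \<and>
    (\<forall>r. forward (shift_pow r S) = \<kappa> \<longrightarrow> S (r - 1) = 1)"
    (is "?L \<longleftrightarrow> ?R")
proof
  assume ?L
  then obtain x where x: "x \<in> inverse_limit f a b" "is_inverse_limit_itinerary f a b c x S"
    by (auto simp: inverse_limit_itineraries_def)
  have "S (r - 1) = 1" if eq: "forward (shift_pow r S) = \<kappa>" for r
  proof -
    have "tracks (\<lambda>i. x (r + int i)) \<kappa>"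
      using bi_tracks_tracks[OF itinerary_bi_tracks[OF x], of r] eq by simp
    from tracks_unique[OF this tracks_kneading] have "x r = b" by simp
    moreover have "x (r - 1) \<in> {a..b}" "f (x (r - 1)) = x r"
      using x(1) by (auto simp: inverse_limit_def)
    ultimately have "x (r - 1) = c" using f_eq_b by auto
    moreover have "codes f a b c (x (r - 1)) (S (r - 1))"
      using x(2) by (auto simp: is_inverse_limit_itinerary_def)
    ultimately show ?thesis using per turn by (auto simp: codes_def)
  qed
  then show ?R
    using itinerary_forward_le[OF x] itinerary_bi_tracks[OF x]
      bi_tracks_left_ones bi_tracks_right_ones by blast
next
  assume R: ?R
  then obtain x where x: "bi_tracks x S" using admissible_bi_tracks by blast
  have "codes f a b c (x r) (S r)" for r
  proof -
    have xr: "x r \<in> {a..b}" "x (r + 1) = f (x r)"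
      using x by (auto simp: bi_tracks_def inverse_limit_def)
    have side: "on_side (S r) (x r)" using x by (simp add: bi_tracks_def)
    show ?thesis
    proof (cases "x r = c")
      case False
      then show ?thesis
        using xr side per by (cases "S r") (auto simp: codes_def on_side_def)
    next
      case True
      let ?s = "forward (shift_pow (r + 1) S)"
      have tr: "tracks (\<lambda>i. x (r + 1 + int i)) ?s" by (rule bi_tracks_tracks[OF x])
      have x0: "x (r + 1 + int 0) = b" using xr True f_c by simp
      have "?s = \<kappa>"
      proof (rule ccontr)
        assume neq: "?s \<noteq> \<kappa>"
        then obtain j where j: "\<forall>i<j. ?s i = \<kappa> i" "?s j \<noteq> \<kappa> j" by (rule first_difference)
        have "(f ^^ j) b = c" by (rule tracks_b_first_difference[OF tr x0 j])
        \<comment> \<open>The two sequences differ at a passage through \<open>c\<close>, after a word that would have to be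
          even in both of them.\<close>
        then have "word_sign \<kappa> (Suc j) = 1" by (rule even)
        then have "\<kappa> \<prec> ?s" using j unfolding unimodal_less_iff by (intro exI[of _ j]) auto
        then show False using R unimodal_not_le_iff by blast
      qed
      then have "S (r + 1 - 1) = 1" using R by blast
      then have "S r = 1" by simp
      then show ?thesis using True per turn by (auto simp: codes_def)
    qed
  qed
  then show ?L
    using x unfolding inverse_limit_itineraries_def is_inverse_limit_itinerary_def bi_tracks_def
    by blast
qed

end

section \<open>Balanced sequences of rational and irrational slope\<close>

text \<open>The pairs of \<open>pair_seq (floor_pairs \<theta>)\<close> follow the cutting sequence of a line of slope \<open>1 / \<theta>\<close>:
  the \<open>i\<close>-th pair starts at the integer part of the point where the line reaches height \<open>i\<close>.\<close>

definition floor_pairs :: "real \<Rightarrow> nat \<Rightarrow> nat" where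
  "floor_pairs \<theta> i = nat \<lfloor>real i * \<theta>\<rfloor>"

definition ceiling_pairs :: "real \<Rightarrow> nat \<Rightarrow> nat" where
  "ceiling_pairs \<theta> i = nat (\<lceil>real i * \<theta>\<rceil> - 1)"

lemma floor_superadditive:
  assumes "2 < \<theta>"
  shows "superadditive_pairs (floor_pairs \<theta>)"
proof
  show "2 \<le> floor_pairs \<theta> 1" using assms by (simp add: floor_pairs_def le_nat_iff le_floor_iff)
  fix i j :: nat
  have "\<lfloor>real i * \<theta>\<rfloor> + \<lfloor>real j * \<theta>\<rfloor> \<le> \<lfloor>real i * \<theta> + real j * \<theta>\<rfloor>" by (rule le_floor_add)
  moreover have "0 \<le> \<lfloor>real i * \<theta>\<rfloor>" "0 \<le> \<lfloor>real j * \<theta>\<rfloor>" using assms by auto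
  ultimately show "floor_pairs \<theta> i + floor_pairs \<theta> j \<le> floor_pairs \<theta> (i + j)"
    by (simp add: floor_pairs_def distrib_right flip: nat_add_distrib)
qed

lemma ceiling_superadditive:
  assumes "2 < \<theta>"
  shows "superadditive_pairs (ceiling_pairs \<theta>)"
proof
  have "2 < \<lceil>\<theta>\<rceil>" using assms by (simp add: less_ceiling_iff)
  then have "nat 2 \<le> nat (\<lceil>\<theta>\<rceil> - 1)" by (intro nat_mono) linarith
  then show "2 \<le> ceiling_pairs \<theta> 1" by (simp add: ceiling_pairs_def)
  fix i j :: nat assume ij: "1 \<le> i" "1 \<le> j"
  have "\<lceil>real i * \<theta>\<rceil> + \<lceil>real j * \<theta>\<rceil> \<le> \<lceil>real i * \<theta> + real j * \<theta>\<rceil> + 1" by linarith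
  moreover have "0 < \<lceil>real i * \<theta>\<rceil>" "0 < \<lceil>real j * \<theta>\<rceil>" using assms ij by auto
  ultimately show "ceiling_pairs \<theta> i + ceiling_pairs \<theta> j \<le> ceiling_pairs \<theta> (i + j)"
    by (simp add: ceiling_pairs_def distrib_right flip: nat_add_distrib)
qed

text \<open>Periodicity would make \<open>\<lfloor>t i \<theta>\<rfloor> + 1\<close> equal to \<open>t (\<lfloor>i \<theta>\<rfloor> + 1)\<close> for some \<open>i\<close> and all \<open>t\<close>, although
  \<open>i \<theta>\<close> is smaller than \<open>\<lfloor>i \<theta>\<rfloor> + 1\<close> by a fixed positive amount.\<close>

lemma floor_seq_not_periodic:
  assumes "2 < \<theta>" "1 \<le> n" and per: "\<And>i. pair_seq (floor_pairs \<theta>) (i + n) = pair_seq (floor_pairs \<theta>) i"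
  shows False
proof -
  interpret superadditive_pairs "floor_pairs \<theta>" by (rule floor_superadditive[OF assms(1)])
  obtain i where i: "i \<ge> 1" "\<forall>t\<ge>1. floor_pairs \<theta> (t * i) + 1 = t * (floor_pairs \<theta> i + 1)"
    using periodic_imp_additive[OF per assms(2)] by blast
  let ?\<delta> = "real_of_int \<lfloor>real i * \<theta>\<rfloor> + 1 - real i * \<theta>"
  have "0 < ?\<delta>" by linarith
  then obtain t where t: "1 < real t * ?\<delta>" using reals_Archimedean3 by blast
  then have "t \<ge> 1" by (cases t) auto
  have real_floor: "real (floor_pairs \<theta> k) = real_of_int \<lfloor>real k * \<theta>\<rfloor>" for k
    using assms(1) by (simp add: floor_pairs_def)
  have "real (floor_pairs \<theta> (t * i) + 1) = real (t * (floor_pairs \<theta> i + 1))"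
    using i \<open>t \<ge> 1\<close> by simp
  then have "real_of_int \<lfloor>real (t * i) * \<theta>\<rfloor> + 1 = real t * (real_of_int \<lfloor>real i * \<theta>\<rfloor> + 1)"
    using real_floor[of i] real_floor[of "t * i"] by (simp add: distrib_left)
  moreover have "real_of_int \<lfloor>real (t * i) * \<theta>\<rfloor> \<le> real t * (real i * \<theta>)"
    by (simp add: mult.assoc)
  ultimately show False using t unfolding right_diff_distrib distrib_left by linarith
qed

lemma pair_seq_cong:
  assumes "superadditive_pairs p" "superadditive_pairs p'"
    and eq: "\<And>i. 1 \<le> i \<Longrightarrow> i \<le> N \<Longrightarrow> p i = p' i" and "x < N"
  shows "pair_seq p x = pair_seq p' x"
proof -
  have large: "i \<le> r i" if "superadditive_pairs r" "1 \<le> i" for r i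
  proof -
    interpret superadditive_pairs r by fact
    show ?thesis using that(2)
    proof (induction i rule: dec_induct)
      case base
      then show ?case using first by simp
    next
      case (step i)
      then show ?case using gap[of i] by simp
    qed
  qed
  have "x = p i \<or> x = p i + 1 \<longleftrightarrow> x = p' i \<or> x = p' i + 1" if "1 \<le> i" for i
  proof (cases "i \<le> N")
    case False
    then show ?thesis using large[OF assms(1) that] large[OF assms(2) that] \<open>x < N\<close> by auto
  qed (use eq that in simp)
  then show ?thesis unfolding pair_seq_def by metis
qed

lemma periodic_eq_iter:
  assumes "\<And>i. s (i + n) = s i" "0 < n"
  shows "s = (prefix n s)\<^sup>\<omega>"
proof
  fix x
  have "s (i + k * n) = s i" for i k
    by (induction k) (auto simp: assms(1) add.assoc[symmetric] add.commute[of n])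
  then have "s x = s (x mod n)" by (metis mod_div_mult_eq)
  then show "s x = (prefix n s)\<^sup>\<omega> x" using assms(2) by simp
qed

subsection \<open>Rational slopes\<close>

locale rational_height =
  fixes q :: rat
  assumes q_pos: "0 < q" and q_less: "q < 1 / 2"
begin

abbreviation "m \<equiv> numer q"
abbreviation "n \<equiv> denom q"

definition \<theta> :: real where "\<theta> = real n / real m"

lemma q_eq: "real_of_rat q = real m / real n" and m_pos: "0 < m" and n_pos: "0 < n"
  and coprime: "coprime m n"
proof -
  obtain u v where uv: "quotient_of q = (u, v)" by (cases "quotient_of q")
  have q: "q = of_int u / of_int v" "0 < v" "coprime u v"
    using uv quotient_of_div quotient_of_denom_pos quotient_of_coprime by blast+
  then have "0 < u" using q_pos by (simp add: zero_less_divide_iff)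
  then have mn: "int m = u" "int n = v" using uv q by (auto simp: numer_def denom_def)
  show "0 < m" "0 < n" using mn \<open>0 < u\<close> \<open>0 < v\<close> by auto
  show "coprime m n" using q(3) unfolding mn[symmetric] by simp
  have "real_of_rat q = real_of_int u / real_of_int v" unfolding q(1) by (simp add: of_rat_divide)
  then show "real_of_rat q = real m / real n" unfolding mn[symmetric] by simp
qed

lemma theta_eq: "\<theta> = 1 / real_of_rat q"
  by (simp add: \<theta>_def q_eq)

lemma theta_gt_2: "2 < \<theta>"
proof -
  have "0 < real_of_rat q" "real_of_rat q < 1 / 2"
    using q_pos q_less of_rat_less[of q "1 / 2"] by (auto simp: of_rat_divide)
  then show ?thesis unfolding theta_eq by (simp add: field_simps)
qed

lemma m_theta: "real m * \<theta> = real n"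
  using m_pos by (simp add: \<theta>_def)

text \<open>Translating the index by \<open>m\<close> translates \<open>i \<theta>\<close> by the integer \<open>n\<close>: the source of all
  periodicity below.\<close>

lemma m_theta_int: "real_of_int (i + k * int m) * \<theta> = real_of_int i * \<theta> + real_of_int (k * int n)"
  using m_theta by (simp add: distrib_right mult.assoc)

lemma not_int: "0 < i \<Longrightarrow> i < m \<Longrightarrow> real i * \<theta> \<notin> \<int>"
proof
  assume i: "0 < i" "i < m" and "real i * \<theta> \<in> \<int>"
  then obtain k where "real i * \<theta> = real_of_int k" by (auto elim: Ints_cases)
  then have "real_of_int (int i * int n) = real_of_int (k * int m)"
    using m_pos by (simp add: \<theta>_def field_simps)
  then have "int i * int n = k * int m" by (simp only: of_int_eq_iff)
  then have "int m dvd int i * int n" by simp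
  then have "m dvd i * n" by (metis int_dvd_int_iff of_nat_mult)
  then have "m dvd i" using coprime by (simp add: coprime_dvd_mult_left_iff)
  then show False using i by (auto dest: dvd_imp_le)
qed

sublocale floor: superadditive_pairs "floor_pairs \<theta>"
  by (rule floor_superadditive[OF theta_gt_2])

sublocale ceiling: superadditive_pairs "ceiling_pairs \<theta>"
  by (rule ceiling_superadditive[OF theta_gt_2])

lemma floor_pairs_int: "int (floor_pairs \<theta> i) = \<lfloor>real i * \<theta>\<rfloor>"
  using theta_gt_2 by (simp add: floor_pairs_def)

lemma ceiling_pairs_int: "0 < i \<Longrightarrow> int (ceiling_pairs \<theta> i) = \<lceil>real i * \<theta>\<rceil> - 1"
proof -
  assume "0 < i"
  then have "0 < \<lceil>real i * \<theta>\<rceil>" using theta_gt_2 by simp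
  then show ?thesis by (simp add: ceiling_pairs_def)
qed

lemma floor_pairs_m: "floor_pairs \<theta> m = n"
  using floor_pairs_int[of m] m_theta by simp

lemma ceiling_pairs_m: "ceiling_pairs \<theta> m = n - 1"
  using ceiling_pairs_int[OF m_pos] m_theta n_pos by simp

lemma ceiling_eq_floor_pairs: "0 < i \<Longrightarrow> i < m \<Longrightarrow> ceiling_pairs \<theta> i = floor_pairs \<theta> i"
  using ceiling_pairs_int[of i] floor_pairs_int[of i] not_int[of i]
  by (simp add: ceiling_altdef Ints_def frac_def split: if_splits)

text \<open>The index \<open>0\<close> yields the initial one and negative indices only negative positions. Letting the
  index run through all integers makes translations and reflections of the index available.\<close>

lemma ceiling_seq_iff:
  "pair_seq (ceiling_pairs \<theta>) x = 1 \<longleftrightarrow>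
     (\<exists>i::int. int x = \<lceil>of_int i * \<theta>\<rceil> - 1 \<or> int x = \<lceil>of_int i * \<theta>\<rceil>)" (is "_ \<longleftrightarrow> (\<exists>i. ?Q i)")
proof
  assume "pair_seq (ceiling_pairs \<theta>) x = 1"
  then consider "x = 0" | i where "i \<ge> 1" "x = ceiling_pairs \<theta> i \<or> x = ceiling_pairs \<theta> i + 1"
    by (auto simp: pair_seq_def split: if_splits)
  then show "\<exists>i. ?Q i"
  proof cases
    case 1
    then show ?thesis by (intro exI[of _ 0]) simp
  next
    case 2
    then show ?thesis using ceiling_pairs_int[of i] by (intro exI[of _ "int i"]) auto
  qed
next
  assume "\<exists>i. ?Q i"
  then obtain i where i: "?Q i" by blast
  consider "i < 0" | "i = 0" | "i > 0" by linarith
  then show "pair_seq (ceiling_pairs \<theta>) x = 1"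
  proof cases
    case 1
    then have "of_int i * \<theta> \<le> (-1) * \<theta>" using theta_gt_2 by (intro mult_right_mono) auto
    then show ?thesis using i theta_gt_2 by linarith
  next
    case 2
    then have "x = 0" using i by auto
    then show ?thesis by simp
  next
    case 3
    then have "x = ceiling_pairs \<theta> (nat i) \<or> x = ceiling_pairs \<theta> (nat i) + 1"
      using i ceiling_pairs_int[of "nat i"] by auto
    then show ?thesis using 3 ceiling.kappa_p[of "nat i"] ceiling.kappa_Suc_p[of "nat i"] by auto
  qed
qed

text \<open>As for the ceilings, but the pair with index \<open>0\<close> would occupy the positions \<open>0\<close> and \<open>1\<close>, and
  position \<open>1\<close> carries a zero.\<close>

lemma floor_seq_iff:
  assumes "2 \<le> x"
  shows "pair_seq (floor_pairs \<theta>) x = 1 \<longleftrightarrow>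
     (\<exists>i::int. int x = \<lfloor>of_int i * \<theta>\<rfloor> \<or> int x = \<lfloor>of_int i * \<theta>\<rfloor> + 1)" (is "_ \<longleftrightarrow> (\<exists>i. ?Q i)")
proof
  assume "pair_seq (floor_pairs \<theta>) x = 1"
  then obtain i where "i \<ge> 1" "x = floor_pairs \<theta> i \<or> x = floor_pairs \<theta> i + 1"
    using assms by (auto simp: pair_seq_def split: if_splits)
  then show "\<exists>i. ?Q i" using floor_pairs_int[of i] by (intro exI[of _ "int i"]) auto
next
  assume "\<exists>i. ?Q i"
  then obtain i where i: "?Q i" by blast
  have "i > 0"
  proof (rule ccontr)
    assume "\<not> i > 0"
    then have "of_int i * \<theta> \<le> 0" using theta_gt_2 by (simp add: mult_le_0_iff)
    then show False using i assms by linarith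
  qed
  then have "x = floor_pairs \<theta> (nat i) \<or> x = floor_pairs \<theta> (nat i) + 1"
    using i floor_pairs_int[of "nat i"] by auto
  then show "pair_seq (floor_pairs \<theta>) x = 1"
    using \<open>i > 0\<close> floor.kappa_p[of "nat i"] floor.kappa_Suc_p[of "nat i"] by auto
qed

lemma bit_eqI: "(e = 1 \<longleftrightarrow> e' = 1) \<Longrightarrow> e = (e' :: bit)"
  by (cases e; cases e') auto

lemma ceiling_seq_periodic: "pair_seq (ceiling_pairs \<theta>) (x + n) = pair_seq (ceiling_pairs \<theta>) x"
proof (rule bit_eqI, unfold ceiling_seq_iff)
  have shift: "\<lceil>of_int (i + k * int m) * \<theta>\<rceil> = \<lceil>of_int i * \<theta>\<rceil> + k * int n" for i k
    unfolding m_theta_int by linarith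
  show "(\<exists>i::int. int (x + n) = \<lceil>of_int i * \<theta>\<rceil> - 1 \<or> int (x + n) = \<lceil>of_int i * \<theta>\<rceil>) \<longleftrightarrow>
        (\<exists>i::int. int x = \<lceil>of_int i * \<theta>\<rceil> - 1 \<or> int x = \<lceil>of_int i * \<theta>\<rceil>)" (is "?L \<longleftrightarrow> ?R")
  proof
    assume ?L
    then obtain i where "int (x + n) = \<lceil>of_int i * \<theta>\<rceil> - 1 \<or> int (x + n) = \<lceil>of_int i * \<theta>\<rceil>" by blast
    then show ?R using shift[of i "-1"] by (intro exI[of _ "i + (-1) * int m"]) linarith
  next
    assume ?R
    then obtain i where "int x = \<lceil>of_int i * \<theta>\<rceil> - 1 \<or> int x = \<lceil>of_int i * \<theta>\<rceil>" by blast
    then show ?L using shift[of i 1] by (intro exI[of _ "i + 1 * int m"]) linarith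
  qed
qed

text \<open>The substitution \<open>i \<mapsto> 2 m - i\<close> exchanges floors and ceilings. This is the palindromic symmetry
  behind the reversed word in the right hand endpoint.\<close>

lemma floor_seq_reflect:
  assumes "2 \<le> y" "y \<le> 2 * n"
  shows "pair_seq (floor_pairs \<theta>) y = pair_seq (ceiling_pairs \<theta>) (2 * n - y)"
proof (rule bit_eqI, unfold ceiling_seq_iff floor_seq_iff[OF assms(1)])
  have reflect: "\<lceil>of_int (- i + 2 * int m) * \<theta>\<rceil> = 2 * int n - \<lfloor>of_int i * \<theta>\<rfloor>" for i
    unfolding m_theta_int by simp linarith
  have y: "int (2 * n - y) = 2 * int n - int y" using assms by simp
  show "(\<exists>i::int. int y = \<lfloor>of_int i * \<theta>\<rfloor> \<or> int y = \<lfloor>of_int i * \<theta>\<rfloor> + 1) \<longleftrightarrow>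
    (\<exists>i::int. int (2 * n - y) = \<lceil>of_int i * \<theta>\<rceil> - 1 \<or> int (2 * n - y) = \<lceil>of_int i * \<theta>\<rceil>)"
    (is "?L \<longleftrightarrow> ?R")
  proof
    assume ?L
    then obtain i where "int y = \<lfloor>of_int i * \<theta>\<rfloor> \<or> int y = \<lfloor>of_int i * \<theta>\<rfloor> + 1" by blast
    then show ?R using reflect[of i] y by (intro exI[of _ "- i + 2 * int m"]) linarith
  next
    assume ?R
    then obtain i where
      "int (2 * n - y) = \<lceil>of_int i * \<theta>\<rceil> - 1 \<or> int (2 * n - y) = \<lceil>of_int i * \<theta>\<rceil>" by blast
    moreover have "- (- i + 2 * int m) + 2 * int m = i" by simp
    ultimately show ?L using reflect[of "- i + 2 * int m"] y
      by (intro exI[of _ "- i + 2 * int m"]) (simp only:, linarith)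
  qed
qed

lemma floor_seq_periodic:
  assumes "2 \<le> x"
  shows "pair_seq (floor_pairs \<theta>) (x + n) = pair_seq (floor_pairs \<theta>) x"
proof (rule bit_eqI)
  have shift: "\<lfloor>of_int (i + k * int m) * \<theta>\<rfloor> = \<lfloor>of_int i * \<theta>\<rfloor> + k * int n" for i k
    unfolding m_theta_int by linarith
  have x: "2 \<le> x + n" using assms by simp
  have "(\<exists>i::int. int (x + n) = \<lfloor>of_int i * \<theta>\<rfloor> \<or> int (x + n) = \<lfloor>of_int i * \<theta>\<rfloor> + 1) \<longleftrightarrow>
        (\<exists>i::int. int x = \<lfloor>of_int i * \<theta>\<rfloor> \<or> int x = \<lfloor>of_int i * \<theta>\<rfloor> + 1)" (is "?L \<longleftrightarrow> ?R")
  proof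
    assume ?L
    then obtain i where "int (x + n) = \<lfloor>of_int i * \<theta>\<rfloor> \<or> int (x + n) = \<lfloor>of_int i * \<theta>\<rfloor> + 1" by blast
    then show ?R using shift[of i "-1"] by (intro exI[of _ "i + (-1) * int m"]) linarith
  next
    assume ?R
    then obtain i where "int x = \<lfloor>of_int i * \<theta>\<rfloor> \<or> int x = \<lfloor>of_int i * \<theta>\<rfloor> + 1" by blast
    then show ?L using shift[of i 1] by (intro exI[of _ "i + 1 * int m"]) linarith
  qed
  then show "pair_seq (floor_pairs \<theta>) (x + n) = 1 \<longleftrightarrow> pair_seq (floor_pairs \<theta>) x = 1"
    unfolding floor_seq_iff[OF assms] floor_seq_iff[OF x] .
qed

text \<open>As \<open>i \<theta>\<close> is not an integer for \<open>0 < i < m\<close>, the two sequences part only at the pair with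
  index \<open>m\<close>, which starts at \<open>n - 1\<close> in one of them and at \<open>n\<close> in the other.\<close>

lemma ceiling_seq_eq_floor_seq:
  assumes "x < n - 1"
  shows "pair_seq (ceiling_pairs \<theta>) x = pair_seq (floor_pairs \<theta>) x"
proof -
  have "x = ceiling_pairs \<theta> i \<or> x = ceiling_pairs \<theta> i + 1 \<longleftrightarrow>
        x = floor_pairs \<theta> i \<or> x = floor_pairs \<theta> i + 1" if "1 \<le> i" for i
  proof (cases "i < m")
    case True
    then show ?thesis using ceiling_eq_floor_pairs[of i] that by simp
  next
    case False
    then have "n - 1 \<le> ceiling_pairs \<theta> i" "n \<le> floor_pairs \<theta> i"
      using ceiling.mono[of m i] floor.mono[of m i] m_pos ceiling_pairs_m floor_pairs_m by auto
    then show ?thesis using assms by auto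
  qed
  then show ?thesis unfolding pair_seq_def by metis
qed

subsection \<open>The words defining the height\<close>

lemma height_k_eq:
  "height_k i (of_rat q) = nat (\<lfloor>real i * \<theta>\<rfloor> - \<lceil>(real i - 1) * \<theta>\<rceil> + 1) - 2"
proof -
  have q0: "0 < real_of_rat q" using q_pos by simp
  have "{v::int. of_rat q * of_int v \<in> {real i - 1..real i}} =
        {\<lceil>(real i - 1) * \<theta>\<rceil>..\<lfloor>real i * \<theta>\<rfloor>}"
    unfolding theta_eq using q0
    by (auto simp: ceiling_le_iff le_floor_iff field_simps)
  then show ?thesis unfolding height_k_def by simp
qed

lemma height_k_1: "height_k (Suc 0) (of_rat q) = floor_pairs \<theta> (Suc 0) - 1"
  unfolding height_k_eq floor_pairs_def by simp

lemma height_k_Suc: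
  assumes "1 \<le> i" "i < m"
  shows "height_k (Suc i) (of_rat q) = floor_pairs \<theta> (Suc i) - (floor_pairs \<theta> i + 2)"
proof -
  have "\<lceil>real i * \<theta>\<rceil> = \<lfloor>real i * \<theta>\<rfloor> + 1"
    using not_int[of i] assms by (simp add: ceiling_altdef) (metis Ints_of_int)
  then show ?thesis
    unfolding height_k_eq using floor_pairs_int[of i] floor_pairs_int[of "Suc i"] by simp
qed

lemma c_word_initial:
  assumes "1 \<le> M" "M \<le> m"
  shows "[1] @ replicate (height_k 1 (of_rat q)) 0 @
     concat (map (\<lambda>i. [1, 1] @ replicate (height_k i (of_rat q)) 0) [2..<Suc M]) =
     prefix (floor_pairs \<theta> M) (pair_seq (floor_pairs \<theta>))" (is "?W M = _")
  using assms
proof (induction M rule: dec_induct)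
  case base
  show ?case
  proof (rule nth_equalityI)
    show "length (?W 1) = length (prefix (floor_pairs \<theta> 1) (pair_seq (floor_pairs \<theta>)))"
      using floor.first by (simp add: height_k_1)
    fix x assume "x < length (?W 1)"
    then have "x < floor_pairs \<theta> 1" using floor.first by (simp add: height_k_1)
    then show "?W 1 ! x = prefix (floor_pairs \<theta> 1) (pair_seq (floor_pairs \<theta>)) ! x"
      using floor.kappa_before_first[of x] by (cases x) (auto simp: height_k_1)
  qed
next
  case (step M)
  let ?p = "floor_pairs \<theta>" and ?s = "pair_seq (floor_pairs \<theta>)"
  let ?k = "?p (Suc M) - (?p M + 2)"
  have gap: "?p M + 2 \<le> ?p (Suc M)" using floor.gap step by simp
  have "?s [?p M \<rightarrow> ?p (Suc M)] = [1, 1] @ replicate ?k 0"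
  proof (rule nth_equalityI)
    show "length (?s [?p M \<rightarrow> ?p (Suc M)]) = length ([1, 1] @ replicate ?k 0)"
      using gap by simp
    fix x assume "x < length (?s [?p M \<rightarrow> ?p (Suc M)])"
    then have x: "x < ?p (Suc M) - ?p M" by simp
    then have "(?s [?p M \<rightarrow> ?p (Suc M)]) ! x = ?s (?p M + x)" by simp
    also have "\<dots> = ([1, 1] @ replicate ?k 0) ! x"
    proof -
      consider "x = 0" | "x = 1" | y where "x = Suc (Suc y)" by (metis One_nat_def not0_implies_Suc)
      then show ?thesis
      proof cases
        case 3
        then show ?thesis using x step floor.kappa_between[of M "?p M + x"] by simp
      qed (use floor.kappa_p[of M] floor.kappa_Suc_p[of M] step in auto)
    qed
    finally show "(?s [?p M \<rightarrow> ?p (Suc M)]) ! x = ([1, 1] @ replicate ?k 0) ! x" .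
  qed
  moreover have "prefix (?p (Suc M)) ?s = prefix (?p M) ?s @ (?s [?p M \<rightarrow> ?p (Suc M)])"
    using subsequence_append[where i = "?p M" and j = "?p (Suc M) - ?p M" and w = ?s] gap by simp
  moreover have "?W (Suc M) = ?W M @ [1, 1] @ replicate ?k 0"
    using step height_k_Suc[of M] by simp
  ultimately show ?case using step by simp
qed

lemma c_word_prefix: "c_word q = prefix (Suc n) (pair_seq (floor_pairs \<theta>))"
proof -
  have "c_word q = prefix n (pair_seq (floor_pairs \<theta>)) @ [1]"
    using c_word_initial[of m] m_pos floor_pairs_m by (simp add: c_word_def)
  moreover have "pair_seq (floor_pairs \<theta>) n = 1"
    using floor.kappa_p[of m] m_pos floor_pairs_m by simp
  ultimately show ?thesis by simp
qed

lemma w_word_prefix: "w_word q = prefix (n - 1) (pair_seq (floor_pairs \<theta>))"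
  by (simp add: w_word_def c_word_prefix min_def del: subseq_to_Suc)

lemma lhe_eq: "lhe q = pair_seq (ceiling_pairs \<theta>)"
proof -
  let ?s = "pair_seq (ceiling_pairs \<theta>)"
  have "prefix n ?s = prefix (n - 1) ?s @ [?s (n - 1)]"
    using subseq_to_Suc[of 0 "n - 1" ?s] n_pos by simp
  also have "prefix (n - 1) ?s = w_word q"
    unfolding w_word_prefix by (rule nth_equalityI) (auto simp: ceiling_seq_eq_floor_seq)
  also have "?s (n - 1) = 1" using ceiling.kappa_p[of m] m_pos ceiling_pairs_m by simp
  finally show ?thesis
    unfolding lhe_def using periodic_eq_iter[of ?s n] ceiling_seq_periodic n_pos by simp
qed

lemma rhe_eq: "rhe q = pair_seq (floor_pairs \<theta>)"
proof
  let ?s = "pair_seq (floor_pairs \<theta>)"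
  define t where "t x = ?s (Suc n + x)" for x
  have "t (x + n) = t x" for x
    unfolding t_def using floor_seq_periodic[of "Suc n + x"] n_pos by (simp add: add_ac)
  then have t: "t = (prefix n t)\<^sup>\<omega>" using n_pos by (intro periodic_eq_iter) auto
  have word: "prefix n t = [1] @ rev (w_word q)"
  proof (rule nth_equalityI)
    show "length (prefix n t) = length ([1] @ rev (w_word q))"
      using n_pos by (simp add: w_word_prefix)
    fix x assume "x < length (prefix n t)"
    then have x: "x < n" by simp
    show "prefix n t ! x = ([1] @ rev (w_word q)) ! x"
    proof (cases x)
      case 0
      then show ?thesis
        using n_pos floor.kappa_Suc_p[of m] m_pos floor_pairs_m by (simp add: t_def)
    next
      case (Suc y)
      have "t x = pair_seq (ceiling_pairs \<theta>) (2 * n - (Suc n + x))"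
        unfolding t_def using x n_pos by (intro floor_seq_reflect) auto
      also have "\<dots> = ?s (n - 1 - x)"
        using x Suc by (subst ceiling_seq_eq_floor_seq) (auto simp: algebra_simps)
      also have "\<dots> = rev (w_word q) ! y"
        using x Suc by (simp add: w_word_prefix rev_nth)
      finally show ?thesis using x Suc by simp
    qed
  qed
  fix x
  show "rhe q x = ?s x"
  proof (cases "x < Suc n")
    case True
    then show ?thesis by (simp add: rhe_def c_word_prefix del: subseq_to_Suc)
  next
    case False
    then have "rhe q x = t (x - Suc n)"
      using t unfolding rhe_def word by (simp add: c_word_prefix del: subseq_to_Suc)
    then show ?thesis using False by (simp add: t_def)
  qed
qed

end

section \<open>Irrational height\<close>

text \<open>As \<open>h\<close> is irrational, no \<open>i / h\<close> with \<open>i \<ge> 1\<close> is an integer, so the finitely many floors do not change in a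
  neighbourhood of \<open>h\<close>.\<close>

lemma floor_quotient_stable:
  fixes h :: real
  assumes "h \<notin> \<rat>" "0 < h" "h < 1 / 2"
  obtains \<delta> where "0 < \<delta>" "\<And>x. \<bar>x - h\<bar> < \<delta> \<Longrightarrow> 0 < x \<and> x < 1 / 2 \<and>
    (\<forall>i\<in>{1..N}. of_int \<lfloor>real i / h\<rfloor> < real i / x \<and> real i / x < of_int \<lfloor>real i / h\<rfloor> + 1)"
proof -
  have "eventually (\<lambda>x. of_int \<lfloor>real i / h\<rfloor> < real i / x \<and> real i / x < of_int \<lfloor>real i / h\<rfloor> + 1)
    (nhds h)" if "i \<in> {1..N}" for i
  proof -
    have "real_of_int \<lfloor>real i / h\<rfloor> \<noteq> real i / h"
    proof
      assume "real_of_int \<lfloor>real i / h\<rfloor> = real i / h"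
      then have "real i / h \<in> \<rat>" by (metis Rats_of_int)
      moreover have "real i / (real i / h) = h" using that by simp
      ultimately have "h \<in> \<rat>" by (metis Rats_divide Rats_of_nat)
      then show False using assms by simp
    qed
    then have "of_int \<lfloor>real i / h\<rfloor> < real i / h" "real i / h < of_int \<lfloor>real i / h\<rfloor> + 1"
      by linarith+
    moreover have "((\<lambda>x. real i / x) \<longlongrightarrow> real i / h) (nhds h)"
      using assms by (intro tendsto_divide tendsto_const filterlim_ident) auto
    ultimately show ?thesis by (intro eventually_conj order_tendstoD)
  qed
  then have "eventually (\<lambda>x. \<forall>i\<in>{1..N}. of_int \<lfloor>real i / h\<rfloor> < real i / x \<and>
      real i / x < of_int \<lfloor>real i / h\<rfloor> + 1) (nhds h)"
    by (intro eventually_ball_finite) auto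
  moreover have "eventually (\<lambda>x. 0 < x) (nhds h)" "eventually (\<lambda>x. x < 1 / 2) (nhds h)"
    using assms eventually_nhds_in_open[of "{0<..}" h] eventually_nhds_in_open[of "{..<1 / 2}" h]
    by simp_all
  ultimately have "eventually (\<lambda>x. 0 < x \<and> x < 1 / 2 \<and> (\<forall>i\<in>{1..N}.
      of_int \<lfloor>real i / h\<rfloor> < real i / x \<and> real i / x < of_int \<lfloor>real i / h\<rfloor> + 1)) (nhds h)"
    by eventually_elim auto
  then show ?thesis using that unfolding eventually_nhds_metric dist_real_def by blast
qed

text \<open>The assumption on \<open>i / q\<close> also forces the numerator \<open>m\<close> of \<open>q\<close> to exceed \<open>N\<close>, since \<open>m / q\<close> is
  an integer; hence \<open>c_word q\<close> is long enough to cover the first \<open>N\<close> positions.\<close>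

lemma (in rational_height) c_word_agrees:
  fixes h :: real
  assumes h: "2 < 1 / h"
    and near: "\<And>i. i \<in> {1..N} \<Longrightarrow> of_int \<lfloor>real i / h\<rfloor> < real i / of_rat q \<and>
      real i / of_rat q < of_int \<lfloor>real i / h\<rfloor> + 1"
    and "x < N"
  shows "(c_word q @ [0])\<^sup>\<omega> x = pair_seq (floor_pairs (1 / h)) x"
proof -
  have "N < m"
  proof (rule ccontr)
    assume "\<not> N < m"
    moreover have "real m / of_rat q = real n" using m_pos by (simp add: q_eq)
    ultimately have "of_int \<lfloor>real m / h\<rfloor> < real n" "real n < of_int \<lfloor>real m / h\<rfloor> + 1"
      using near[of m] m_pos by simp_all
    then have "real_of_int \<lfloor>real m / h\<rfloor> < real_of_int (int n)"
      "real_of_int (int n) < real_of_int (\<lfloor>real m / h\<rfloor> + 1)" by simp_all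
    then show False unfolding of_int_less_iff by simp
  qed
  moreover have "m < n"
  proof -
    have "2 * real m < \<theta> * real m" using theta_gt_2 m_pos by simp
    then show ?thesis using m_theta by (simp add: mult.commute)
  qed
  ultimately have x: "x < n" using \<open>x < N\<close> by simp
  then have "(c_word q @ [0])\<^sup>\<omega> x = pair_seq (floor_pairs \<theta>) x"
    by (simp add: c_word_prefix nth_append del: subseq_to_Suc)
  also have "\<dots> = pair_seq (floor_pairs (1 / h)) x"
  proof (rule pair_seq_cong[OF floor.superadditive_pairs_axioms floor_superadditive[OF h] _ \<open>x < N\<close>])
    fix i assume "1 \<le> i" "i \<le> N"
    then have "\<lfloor>real i / of_rat q\<rfloor> = \<lfloor>real i / h\<rfloor>" using near[of i] by (intro floor_unique) auto
    then show "floor_pairs \<theta> i = floor_pairs (1 / h) i" by (simp add: floor_pairs_def theta_eq)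
  qed
  finally show ?thesis .
qed

text \<open>Rationals \<open>q\<close> just below and just above the height give words \<open>(c_word q @ [0])\<^sup>\<omega>\<close> that agree
  with the claimed sequence on any prescribed prefix, and \<open>s\<close> lies between these words in the
  unimodal order. A first difference between \<open>s\<close> and the claimed sequence would put both words
  on the same side of \<open>s\<close>.\<close>

theorem irrational_height_seq:
  assumes "height s \<notin> \<rat>"
  shows "\<exists>\<theta>>2. s = pair_seq (floor_pairs \<theta>)"
proof -
  define A where "A = {of_rat q | q. 0 < q \<and> q \<le> 1 / 2 \<and> (c_word q @ [0])\<^sup>\<omega> \<prec> s} \<union> {1 / 2 :: real}"
  define h where "h = height s"
  have h: "h = Inf A" by (simp add: h_def height_def A_def)
  have bdd: "bdd_below A" by (rule bdd_belowI[of _ 0]) (auto simp: A_def)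
  have "0 \<le> h" unfolding h by (rule cInf_greatest) (auto simp: A_def)
  moreover have "h \<le> 1 / 2" unfolding h using bdd by (intro cInf_lower) (auto simp: A_def)
  moreover have irr: "h \<notin> \<rat>" using assms h_def by simp
  moreover have "0 \<in> (\<rat> :: real set)" "1 / 2 \<in> (\<rat> :: real set)" by auto
  ultimately have h0: "0 < h" and h2: "h < 1 / 2" by (metis order_le_less)+
  have theta: "2 < 1 / h" using h0 h2 by (simp add: field_simps)
  let ?t = "pair_seq (floor_pairs (1 / h))"
  have "s = ?t"
  proof (rule ccontr)
    assume "s \<noteq> ?t"
    then have "?t \<noteq> s" by simp
    then obtain r where r: "\<forall>i<r. ?t i = s i" "?t r \<noteq> s r" by (rule first_difference)
    obtain \<delta> where \<delta>: "0 < \<delta>" "\<And>x. \<bar>x - h\<bar> < \<delta> \<Longrightarrow> 0 < x \<and> x < 1 / 2 \<and>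
      (\<forall>i\<in>{1..Suc r}. of_int \<lfloor>real i / h\<rfloor> < real i / x \<and> real i / x < of_int \<lfloor>real i / h\<rfloor> + 1)"
      using floor_quotient_stable[OF irr h0 h2] by blast
    have agree: "rational_height q \<and> ((c_word q @ [0])\<^sup>\<omega> \<prec> s \<longleftrightarrow> ?t \<prec> s)"
      if q: "\<bar>of_rat q - h\<bar> < \<delta>" for q
    proof -
      note \<delta>q = \<delta>(2)[OF q]
      have rat: "rational_height q"
      proof
        show "0 < q" using \<delta>q by simp
        have "of_rat q < (of_rat (1 / 2) :: real)" using \<delta>q by (simp add: of_rat_divide)
        then show "q < 1 / 2" by (simp only: of_rat_less)
      qed
      let ?c = "(c_word q @ [0])\<^sup>\<omega>"
      have eq: "?c x = ?t x" if "x < Suc r" for x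
        using \<delta>q that by (intro rational_height.c_word_agrees[OF rat theta, of "Suc r"]) auto
      have "word_sign ?c (Suc r) = word_sign ?t (Suc r)" using eq by (intro word_sign_cong)
      moreover have "?c \<prec> s \<longleftrightarrow> word_sign ?c (Suc r) = 1"
        using r eq by (intro unimodal_less_at) auto
      ultimately show ?thesis using rat unimodal_less_at[OF r] by simp
    qed
    obtain q1 where q1: "h - \<delta> < of_rat q1" "of_rat q1 < h"
      using of_rat_dense[of "h - \<delta>" h] \<delta>(1) by auto
    then have near1: "\<bar>of_rat q1 - h\<bar> < \<delta>" by simp
    have "\<not> (c_word q1 @ [0])\<^sup>\<omega> \<prec> s"
    proof
      assume "(c_word q1 @ [0])\<^sup>\<omega> \<prec> s"
      moreover have "0 < q1" "q1 \<le> 1 / 2" using agree[OF near1] by (auto simp: rational_height_def)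
      ultimately have "of_rat q1 \<in> A" unfolding A_def by blast
      then have "h \<le> of_rat q1" unfolding h using bdd by (rule cInf_lower)
      then show False using q1 by simp
    qed
    then have not_less: "\<not> ?t \<prec> s" using agree[OF near1] by simp
    have "A \<noteq> {}" by (simp add: A_def)
    moreover have "Inf A < min (h + \<delta>) (1 / 2)" using h h2 \<delta>(1) by simp
    ultimately obtain y where y: "y \<in> A" "y < min (h + \<delta>) (1 / 2)" using cInf_lessD by blast
    then obtain q2 where q2: "y = of_rat q2" "(c_word q2 @ [0])\<^sup>\<omega> \<prec> s" by (auto simp: A_def)
    have "h \<le> y" unfolding h using y bdd by (intro cInf_lower) auto
    then have "\<bar>of_rat q2 - h\<bar> < \<delta>" using y q2 by simp
    then show False using agree q2 not_less by blast
  qed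
  then show ?thesis using theta by blast
qed

section \<open>Backward admissibility\<close>

lemma ends_in_zeros_iff: "ends_in_zeros S \<longleftrightarrow> \<not> (\<forall>r. \<exists>r'>r. S r' = 1)"
proof
  assume "ends_in_zeros S"
  then obtain N where "\<forall>j. forward S j = 1 \<longrightarrow> j < N"
    unfolding ends_in_zeros_def finite_nat_set_iff_bounded by auto
  then have "\<not> (\<exists>r'>int N. S r' = 1)"
    unfolding forward_def by (metis less_le_not_le linorder_le_less_linear nat_int nat_less_iff of_nat_0_le_iff order_trans zero_le_imp_eq_int)
  then show "\<not> (\<forall>r. \<exists>r'>r. S r' = 1)" by blast
next
  assume "\<not> (\<forall>r. \<exists>r'>r. S r' = 1)"
  then obtain r where r: "\<And>r'. r' > r \<Longrightarrow> S r' \<noteq> 1" by blast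
  have "{j. forward S j = 1} \<subseteq> {..nat r}"
  proof
    fix j assume "j \<in> {j. forward S j = 1}"
    then have "\<not> r < int j" using r[of "int j"] by (auto simp: forward_def)
    then show "j \<in> {..nat r}" by auto
  qed
  then show "ends_in_zeros S" unfolding ends_in_zeros_def by (rule finite_subset) simp
qed

text \<open>Only ones on the right are demanded explicitly in terms of backward sequences; those on the left
  are a consequence of the bound.\<close>

lemma (in superadditive_pairs) forward_conditions_iff:
  "(\<forall>r. forward (shift_pow r S) \<preceq> \<kappa>) \<and> (\<forall>r. \<exists>r'<r. S r' = 1) \<and> (\<forall>r. \<exists>r'>r. S r' = 1) \<longleftrightarrow>
   (\<forall>r. backward (shift_pow r S) \<preceq> \<kappa>) \<and> \<not> ends_in_zeros S"
  using forward_iff_backward_bounded[of S] left_ones_of_backward_bounded[of S]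
  unfolding ends_in_zeros_iff by blast

theorem theorem14:
  fixes f :: "real \<Rightarrow> real" and a b c slope :: real and S :: "int \<Rightarrow> bit"
  assumes "tent_map f a b c slope"
    and "sqrt 2 < slope" and "slope < 2"
    and "irrational_type f a b c \<or> rational_endpoint_type f a b c"
  shows "S \<in> inverse_limit_itineraries f a b c \<longleftrightarrow>
    (\<forall>r. backward (shift_pow r S) \<preceq> kneading_seq f a b c) \<and>
    \<not> ends_in_zeros S \<and>
    (rational_left_endpoint_type f a b c \<longrightarrow>
       (\<forall>r. forward (shift_pow r S) = kneading_seq f a b c \<longrightarrow> S (r - 1) = 1))"
proof -
  have "1 < sqrt 2" by simp
  then have "1 < slope" using assms(2) by linarith
  then interpret core_tent_map f a b c slope using assms by unfold_locales
  show ?thesis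
  proof (cases "rational_left_endpoint_type f a b c")
    case True
    then obtain q where q: "0 < q" "q < 1 / 2" "\<kappa> = lhe q"
      by (auto simp: rational_left_endpoint_type_def)
    interpret q: rational_height q using q by unfold_locales
    have kappa: "\<kappa> = pair_seq (ceiling_pairs q.\<theta>)" using q q.lhe_eq by simp
    have per: "\<kappa> (i + Suc (q.n - 1)) = \<kappa> i" for i
      using q.ceiling_seq_periodic q.n_pos by (simp add: kappa)
    have "\<kappa> (q.n - 1) = 1"
      using q.ceiling.kappa_p[of q.m] q.m_pos q.ceiling_pairs_m by (simp add: kappa)
    then have periodic: "periodic_pt f c" and turn: "turning_symbol f b c = 1"
      using kneading_periodic[OF per] by auto
    have even: "word_sign \<kappa> (Suc j) = 1" if "(f ^^ j) b = c" for j
    proof -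
      have "(f ^^ Suc j) b = b" using that f_c by simp
      then have perj: "\<kappa> (i + Suc j) = \<kappa> i" for i by (rule kneading_shift_eq)
      then have "\<kappa> j = 1" using kneading_periodic(2) turn by metis
      then show ?thesis using q.ceiling.periodic_prefix_even[of j] perj by (simp only: kappa)
    qed
    show ?thesis
      using itinerary_iff_forward_periodic[OF periodic turn even, of S]
        q.ceiling.forward_conditions_iff[of S] True unfolding kappa[symmetric] by blast
  next
    case False
    have "\<exists>\<theta>>2. \<kappa> = pair_seq (floor_pairs \<theta>)"
    proof (cases "irrational_type f a b c")
      case True
      then show ?thesis by (intro irrational_height_seq) (simp add: irrational_type_def)
    next
      case nonirrational: False
      then obtain q where q: "0 < q" "q < 1 / 2" "\<kappa> = rhe q"
        using assms(4) False
        by (auto simp: rational_right_endpoint_type_def rational_endpoint_type_def)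
      interpret q: rational_height q using q by unfold_locales
      show ?thesis using q q.rhe_eq q.theta_gt_2 by auto
    qed
    then obtain \<theta> where \<theta>: "2 < \<theta>" "\<kappa> = pair_seq (floor_pairs \<theta>)" by blast
    interpret p: superadditive_pairs "floor_pairs \<theta>" by (rule floor_superadditive[OF \<theta>(1)])
    have "\<not> periodic_pt f c"
    proof
      assume "periodic_pt f c"
      then obtain k where "k \<ge> 1" "\<And>i. \<kappa> (i + k) = \<kappa> i"
        by (rule periodic_imp_kneading_periodic) auto
      then show False using floor_seq_not_periodic[OF \<theta>(1), of k] \<theta>(2) by simp
    qed
    then show ?thesis
      using itinerary_iff_forward_nonperiodic[of S] p.forward_conditions_iff[of S] False
      unfolding \<theta>(2)[symmetric] by blast
  qed
qed

end
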